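(* For integers $m\ge 2$ and $n\ge 4$, $\Delta_2^t(K_m\,\square\, C_n)\simeq \bigvee_{n(m-1)+1}\mathbb{S}^{mn-4}$, a wedge of $n(m-1)+1$ spheres of dimension $mn-4$.
   Context: All graphs are finite and simple. For a graph $G$, the total $2$-cut complex $\Delta_2^t(G)$ is the simplicial complex on vertex set $V(G)$ whose facets are the subsets $\sigma\subseteq V(G)$ with $|\sigma|=|V(G)|-2$ such that the induced subgraph $G[V(G)\setminus\sigma]$ has no edge. $K_m$ is the complete graph on $m$ vertices and $C_n$ the cycle graph with vertices $0,\dots,n-1$ and edges $\{i,i+1\}$ ($0\le i\le n-2$) and $\{0,n-1\}$. The Cartesian product $G\,\square\, H$ has vertex set $V(G)\times V(H)$, with $(u_1,v_1)\sim(u_2,v_2)$ iff either $u_1=u_2$ and $v_1v_2\in E(H)$, or $v_1=v_2$ and $u_1u_2\in E(G)$. $\simeq$ denotes homotopy equivalence. *)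

theory Defs
  imports "HOL-Analysis.Analysis"
begin

record 'a sgraph =
  vertices :: "'a set"
  edges :: "'a set set"

definition finite_simple_graph :: "'a sgraph \<Rightarrow> bool" where
  "finite_simple_graph G \<longleftrightarrow>
     finite (vertices G) \<and> (\<forall>e \<in> edges G. e \<subseteq> vertices G \<and> card e = 2)"

definition induced_subgraph :: "'a sgraph \<Rightarrow> 'a set \<Rightarrow> 'a sgraph" where
  "induced_subgraph G S = \<lparr>vertices = S, edges = {e \<in> edges G. e \<subseteq> S}\<rparr>"

definition complete_graph :: "nat \<Rightarrow> nat sgraph" where
  "complete_graph m = \<lparr>vertices = {0..<m}, edges = {{i, j} | i j. i < m \<and> j < m \<and> i \<noteq> j}\<rparr>"

text \<open>The cycle on \<open>n\<close> vertices only for \<open>n \<ge> 3\<close>; not a simple graph for \<open>n < 2\<close>.\<close>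

definition cycle_graph :: "nat \<Rightarrow> nat sgraph" where
  "cycle_graph n =
     \<lparr>vertices = {0..<n}, edges = {{i, i + 1} | i. i + 1 < n} \<union> {{0, n - 1}}\<rparr>"

definition cartesian_product :: "'a sgraph \<Rightarrow> 'b sgraph \<Rightarrow> ('a \<times> 'b) sgraph"
    (infixl \<open>\<box>\<close> 70) where
  "G \<box> H =
     \<lparr>vertices = vertices G \<times> vertices H,
      edges = {{(u\<^sub>1, v\<^sub>1), (u\<^sub>2, v\<^sub>2)} | u\<^sub>1 v\<^sub>1 u\<^sub>2 v\<^sub>2.
                 (u\<^sub>1 = u\<^sub>2 \<and> u\<^sub>1 \<in> vertices G \<and> {v\<^sub>1, v\<^sub>2} \<in> edges H) \<or>
                 (v\<^sub>1 = v\<^sub>2 \<and> v\<^sub>1 \<in> vertices H \<and> {u\<^sub>1, u\<^sub>2} \<in> edges G)}\<rparr>"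

lemma finite_simple_graph_complete_graph: "finite_simple_graph (complete_graph m)"
  by (auto simp: finite_simple_graph_def complete_graph_def)

lemma finite_simple_graph_cycle_graph: "n \<ge> 2 \<Longrightarrow> finite_simple_graph (cycle_graph n)"
  by (auto simp: finite_simple_graph_def cycle_graph_def)

lemma finite_simple_graph_cartesian_product:
  assumes "finite_simple_graph G" "finite_simple_graph H"
  shows "finite_simple_graph (G \<box> H)"
proof -
  have G: "finite (vertices G)" "\<And>e. e \<in> edges G \<Longrightarrow> e \<subseteq> vertices G \<and> card e = 2"
    and H: "finite (vertices H)" "\<And>e. e \<in> edges H \<Longrightarrow> e \<subseteq> vertices H \<and> card e = 2"
    using assms by (auto simp: finite_simple_graph_def)
  have "e \<subseteq> vertices (G \<box> H) \<and> card e = 2" if e: "e \<in> edges (G \<box> H)" for e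
  proof -
    from e obtain u1 v1 u2 v2 where eq: "e = {(u1, v1), (u2, v2)}"
      and "(u1 = u2 \<and> u1 \<in> vertices G \<and> {v1, v2} \<in> edges H) \<or>
           (v1 = v2 \<and> v1 \<in> vertices H \<and> {u1, u2} \<in> edges G)"
      by (auto simp: cartesian_product_def)
    then show ?thesis
      using G(2)[of "{u1, u2}"] H(2)[of "{v1, v2}"]
      by (auto simp: cartesian_product_def card_insert_if split: if_splits)
  qed
  then show ?thesis
    using G(1) H(1) by (simp add: finite_simple_graph_def cartesian_product_def)
qed

text \<open>Abstract simplicial complexes are given by their sets of faces, including the empty face.
  The size condition \<open>|\<sigma>| = |V(G)| - 2\<close> is written without subtraction because subtraction on
  \<^typ>\<open>nat\<close> truncates.\<close>

definition total_2_cut_facets :: "'a sgraph \<Rightarrow> 'a set set" where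
  "total_2_cut_facets G =
     {\<sigma>. \<sigma> \<subseteq> vertices G \<and> card \<sigma> + 2 = card (vertices G) \<and>
         edges (induced_subgraph G (vertices G - \<sigma>)) = {}}"

definition total_2_cut_complex :: "'a sgraph \<Rightarrow> 'a set set" where
  "total_2_cut_complex G = {\<tau>. \<exists>\<sigma> \<in> total_2_cut_facets G. \<tau> \<subseteq> \<sigma>}"

text \<open>Points are given by their barycentric coordinates, extended by 0 outside the carrier face
  (in particular outside the vertex set). The product topology is the right one for finite
  complexes; for infinite complexes it may be strictly coarser than the weak topology.\<close>

definition geometric_realization :: "'a set set \<Rightarrow> ('a \<Rightarrow> real) topology" where
  "geometric_realization K =
     subtopology (powertop_real UNIV)
       {x. (\<forall>v. 0 \<le> x v) \<and> {v. x v \<noteq> 0} \<in> K \<and> (\<Sum>v | x v \<noteq> 0. x v) = 1}"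

definition quotient_topology :: "'a topology \<Rightarrow> ('a \<Rightarrow> 'b) \<Rightarrow> 'b topology" where
  "quotient_topology X q =
     topology (\<lambda>U. U \<subseteq> q ` topspace X \<and> openin X {x \<in> topspace X. q x \<in> U})"

lemma istopology_quotient_topology:
  "istopology (\<lambda>U. U \<subseteq> q ` topspace X \<and> openin X {x \<in> topspace X. q x \<in> U})"
proof -
  have "{x \<in> topspace X. q x \<in> S \<inter> T} =
        {x \<in> topspace X. q x \<in> S} \<inter> {x \<in> topspace X. q x \<in> T}" for S T
    by auto
  moreover have "{x \<in> topspace X. q x \<in> \<Union>\<K>} = (\<Union>U\<in>\<K>. {x \<in> topspace X. q x \<in> U})" for \<K>
    by auto
  ultimately show ?thesis
    unfolding istopology_def by (auto simp del: Int_iff Union_iff)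
qed

lemma openin_quotient_topology:
  "openin (quotient_topology X q) U \<longleftrightarrow>
     U \<subseteq> q ` topspace X \<and> openin X {x \<in> topspace X. q x \<in> U}"
  by (simp add: quotient_topology_def topology_inverse'[OF istopology_quotient_topology])

lemma topspace_quotient_topology [simp]:
  "topspace (quotient_topology X q) = q ` topspace X"
proof
  show "topspace (quotient_topology X q) \<subseteq> q ` topspace X"
    by (auto simp: topspace_def openin_quotient_topology)
  have "{x \<in> topspace X. q x \<in> q ` topspace X} = topspace X"
    by auto
  then have "openin (quotient_topology X q) (q ` topspace X)"
    by (simp add: openin_quotient_topology)
  then show "q ` topspace X \<subseteq> topspace (quotient_topology X q)"
    by (rule openin_subset)
qed

lemma quotient_map_quotient_topology: "quotient_map X (quotient_topology X q) q"
  by (simp add: quotient_map_def openin_quotient_topology)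

text \<open>The wedge of the pointed spaces \<open>(X i, b i)\<close> for \<open>i \<in> I\<close>, with \<open>I\<close> nonempty: the disjoint
  union with all basepoints identified to the single point \<^term>\<open>None\<close>.\<close>

definition wedge_collapse :: "('i \<Rightarrow> 'a) \<Rightarrow> 'i \<times> 'a \<Rightarrow> ('i \<times> 'a) option" where
  "wedge_collapse b = (\<lambda>(i, x). if x = b i then None else Some (i, x))"

definition wedge_sum ::
    "('i \<Rightarrow> 'a topology) \<Rightarrow> ('i \<Rightarrow> 'a) \<Rightarrow> 'i set \<Rightarrow> ('i \<times> 'a) option topology" where
  "wedge_sum X b I = quotient_topology (sum_topology X I) (wedge_collapse b)"

definition nsphere_basepoint :: "nat \<Rightarrow> real" where
  "nsphere_basepoint = (\<lambda>i. if i = 0 then 1 else 0)"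

lemma nsphere_basepoint_in_nsphere: "nsphere_basepoint \<in> topspace (nsphere d)"
proof -
  have "(\<Sum>i\<le>d. nsphere_basepoint i ^ 2) = (\<Sum>i\<le>d. if i = 0 then 1 else 0)"
    by (rule sum.cong) (auto simp: nsphere_basepoint_def)
  then show ?thesis
    by (simp add: nsphere topspace_product_topology) (simp add: nsphere_basepoint_def)
qed

definition wedge_of_spheres :: "nat \<Rightarrow> nat \<Rightarrow> (nat \<times> (nat \<Rightarrow> real)) option topology" where
  "wedge_of_spheres k d = wedge_sum (\<lambda>_. nsphere d) (\<lambda>_. nsphere_basepoint) {0..<k}"

end

theory Submission
  imports Defs
begin

text \<open>The complement map turns \<open>\<Delta>\<^sub>2\<^sup>t(G)\<close> into the Alexander dual of the clique complex \<open>X\<close>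
  of \<open>G\<close>, and expansions of \<open>X\<close> within the same vertex set into collapses of the dual. For
  \<open>K\<^sub>m \<box> C\<^sub>n\<close> the columns (copies of \<open>K\<^sub>m\<close>) together with a path through them form a
  contractible subcomplex \<open>T\<close>, and \<open>n (m - 1) + 1\<close> horizontal edges remain. For a vertex \<open>v\<close> on no
  remaining edge, \<open>X\<close> expands to \<open>X \<union> v * T\<close>, whose dual \<open>K\<close> consists of the dual \<open>L\<close> of the
  cone \<open>v * X\<close> and one further facet, the complement of \<open>{v} \<union> e\<close>, for each remaining
  edge \<open>e\<close>. As \<open>L\<close> is itself a cone with apex \<open>v\<close>, \<open>|K| \<simeq> |K|/|L|\<close> is a wedge of
  spheres of dimension \<open>m n - 4\<close>.\<close>

section \<open>Geometric realizations and collapses\<close>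

text \<open>The clique complex itself is easy, a graph of simplices with the homotopy type of a
  wedge of circles, but this settles nothing about its dual: Alexander duality transports homology,
  not homotopy type, and the dual depends on the ambient vertex set. Contracting \<open>T\<close>
  would change that set. This is why the cone over \<open>T\<close> is added inside \<open>V\<close>
  instead, by single moves that pair off faces through one vertex and therefore dualise to explicit
  deformations.

  The bound n \<ge> 4 enters because the cycle must have no triangle: a clique that meets two
  columns is then a single horizontal edge. Each such edge together with the apex has three
  vertices, so its complement has m n - 3 vertices and spans a simplex of dimension m n - 4.

  On the topological side the difficulty is to extend the contraction of |L| to all of |K|. In place
  of a general homotopy extension theorem, one explicit formula is used, valid on all cells at
  once.\<close>

abbreviation carrier_face :: "('a \<Rightarrow> real) \<Rightarrow> 'a set" where
  "carrier_face x \<equiv> {u. x u \<noteq> 0}"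

definition down_closed :: "'a set set \<Rightarrow> bool" where
  "down_closed K \<longleftrightarrow> (\<forall>\<sigma>\<in>K. Pow \<sigma> \<subseteq> K)"

lemma down_closedD: "down_closed K \<Longrightarrow> \<sigma> \<in> K \<Longrightarrow> \<tau> \<subseteq> \<sigma> \<Longrightarrow> \<tau> \<in> K"
  by (auto simp: down_closed_def)

text \<open>The sum over the carrier, which varies with the point, is traded for a sum over the
  fixed finite set \<open>V\<close>; the latter is visibly continuous in \<open>x\<close>.\<close>

lemma topspace_geometric_realization:
  assumes "finite V" "K \<subseteq> Pow V"
  shows "x \<in> topspace (geometric_realization K) \<longleftrightarrow>
           (\<forall>u. 0 \<le> x u) \<and> carrier_face x \<in> K \<and> sum x V = 1"
proof -
  have "sum x V = sum x (carrier_face x)" if "carrier_face x \<in> K"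
    by (rule sum.mono_neutral_right) (use assms that in auto)
  then show ?thesis
    by (auto simp: geometric_realization_def)
qed

lemma continuous_map_coordinate [continuous_intros]:
  "continuous_map (geometric_realization K) euclideanreal (\<lambda>x. x u)"
  unfolding geometric_realization_def
  by (intro continuous_map_from_subtopology continuous_map_product_projection) auto

lemma continuous_map_coordinate_snd [continuous_intros]:
  "continuous_map (prod_topology T (geometric_realization K)) euclideanreal (\<lambda>p. snd p u)"
  using continuous_map_compose[OF continuous_map_snd continuous_map_coordinate, of T K u]
  by (simp add: o_def)

lemma continuous_map_fst_real [continuous_intros]:
  "continuous_map (prod_topology (top_of_set S) X) euclideanreal fst" for S :: "real set"
  using continuous_map_fst continuous_map_into_fulltopology by blast

lemma continuous_map_into_geometric_realization:
  assumes "\<And>u. continuous_map X euclideanreal (\<lambda>x. f x u)"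
    and "\<And>x. x \<in> topspace X \<Longrightarrow> f x \<in> topspace (geometric_realization K)"
  shows "continuous_map X (geometric_realization K) f"
proof -
  have "continuous_map X (powertop_real UNIV) f"
    by (simp add: assms(1) continuous_map_componentwise_UNIV)
  moreover have "f \<in> topspace X \<rightarrow> {x. (\<forall>v. 0 \<le> x v) \<and> {v. x v \<noteq> 0} \<in> K \<and> (\<Sum>v | x v \<noteq> 0. x v) = 1}"
    using assms(2) by (auto simp: geometric_realization_def)
  ultimately show ?thesis
    unfolding geometric_realization_def by (simp add: continuous_map_in_subtopology)
qed

lemma continuous_map_Min:
  fixes f :: "'i \<Rightarrow> 'a \<Rightarrow> real"
  assumes "finite A" "A \<noteq> {}" "\<And>a. a \<in> A \<Longrightarrow> continuous_map X euclideanreal (f a)"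
  shows "continuous_map X euclideanreal (\<lambda>x. Min ((\<lambda>a. f a x) ` A))"
  using assms
proof (induction A rule: finite_ne_induct)
  case (insert a A)
  have "(\<lambda>x. Min ((\<lambda>a. f a x) ` insert a A)) = (\<lambda>x. min (f a x) (Min ((\<lambda>a. f a x) ` A)))"
    using insert by auto
  then show ?case
    using insert by (simp add: continuous_map_real_min)
qed auto

text \<open>An elementary collapse: mass is drained at equal speed from all vertices other than \<open>w\<close>
  and poured into \<open>w\<close>; the draining stops exactly when the carrier enters \<open>K'\<close>.\<close>

lemma homotopy_equivalent_collapse:
  fixes V :: "'a set"
  assumes V: "finite V" "w \<in> V" and K: "K \<subseteq> Pow V" "down_closed K"
    and K': "K' \<subseteq> K" "down_closed K'" "K' \<noteq> {}"
    and toggle: "\<And>\<sigma>. \<sigma> \<in> K - K' \<Longrightarrow> insert w \<sigma> \<in> K - K' \<and> \<sigma> - {w} \<in> K - K'"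
  shows "geometric_realization K homotopy_equivalent_space geometric_realization K'"
proof -
  have K'V: "K' \<subseteq> Pow V" and finK': "finite K'"
    using K K' V finite_subset[of K' "Pow V"] by auto
  note inK = topspace_geometric_realization[OF V(1) K(1)]
  note inK' = topspace_geometric_realization[OF V(1) K'V]
  \<comment> \<open>\<open>T x\<close> is the amount drained from each coordinate: the least mass,
    over the faces \<tau> of \<open>K'\<close>, that \<open>x\<close> has outside \<tau> and
    \<open>w\<close>. A single coordinate outside the minimising \<tau> is at most this sum, so it
    is empty at time 1. On |K'| the amount is 0, so points there stay fixed.\<close>
  define g where "g \<tau> x = sum x (V - {w} - \<tau>)" for \<tau> and x :: "'a \<Rightarrow> real"
  define T where "T x = Min ((\<lambda>\<tau>. g \<tau> x) ` K')" for x
  define h where "h s x u = (if u = w then 1 - (\<Sum>u\<in>V - {w}. max 0 (x u - s * T x))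
                             else if u \<in> V then max 0 (x u - s * T x) else 0)" for s x u
  have T0: "0 \<le> T x" if "\<forall>u. 0 \<le> x u" for x
    using that finK' K'(3) by (auto simp: T_def g_def intro!: sum_nonneg)
  have Tatt: "\<exists>\<tau>\<in>K'. T x = g \<tau> x" for x
  proof -
    have "Min ((\<lambda>\<tau>. g \<tau> x) ` K') \<in> (\<lambda>\<tau>. g \<tau> x) ` K'"
      using finK' K'(3) by (intro Min_in) auto
    then show ?thesis by (auto simp: T_def)
  qed
  have Tz: "T x = 0" if "\<forall>u. 0 \<le> x u" "carrier_face x \<in> K'" for x
  proof -
    have "T x \<le> g (carrier_face x) x"
      using that finK' by (auto simp: T_def)
    also have "\<dots> = 0" by (simp add: g_def)
    finally show ?thesis using T0[OF that(1)] by simp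
  qed
  have sumV: "sum y V = y w + sum y (V - {w})" for y :: "'a \<Rightarrow> real"
    using V by (simp add: sum.remove)
  have sumh: "sum (h s x) (V - {w}) = (\<Sum>u\<in>V - {w}. max 0 (x u - s * T x))" for s x
    by (rule sum.cong) (auto simp: h_def)
  have hid: "h s x = x" if "x \<in> topspace (geometric_realization K)" "s * T x = 0" for s x
  proof
    fix u
    have x: "\<forall>u. 0 \<le> x u" "carrier_face x \<in> K" "sum x V = 1"
      using that(1) inK by auto
    have "u \<notin> V \<Longrightarrow> x u = 0" using x(2) K(1) by blast
    moreover have "(\<Sum>u\<in>V - {w}. max 0 (x u)) = (\<Sum>u\<in>V - {w}. x u)"
      by (rule sum.cong) (use x in \<open>auto simp: max_def intro: antisym\<close>)
    ultimately show "h s x u = x u"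
      using x that(2) sumV[of x] by (auto simp: h_def max_def intro: antisym)
  qed
  have hsub: "h s x u \<noteq> 0 \<Longrightarrow> u = w \<or> u \<in> V \<and> x u \<noteq> 0"
    if "\<forall>u. 0 \<le> x u" "0 \<le> s" for s x u
  proof -
    have "0 \<le> s * T x" using that T0[OF that(1)] by simp
    then have "x u \<noteq> 0" if "max 0 (x u - s * T x) \<noteq> 0"
      using that by linarith
    then show "h s x u \<noteq> 0 \<Longrightarrow> u = w \<or> u \<in> V \<and> x u \<noteq> 0"
      by (simp add: h_def split: if_splits)
  qed
  have hK: "h s x \<in> topspace (geometric_realization K)"
    if x: "x \<in> topspace (geometric_realization K)" and s: "0 \<le> s" for s x
  proof (cases "carrier_face x \<in> K'")
    case True
    then show ?thesis using hid[OF x] Tz x inK by auto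
  next
    case False
    have x': "\<forall>u. 0 \<le> x u" "carrier_face x \<in> K" "sum x V = 1"
      using x inK by auto
    have "insert w (carrier_face x) \<in> K" using toggle False x' by blast
    moreover have "carrier_face (h s x) \<subseteq> insert w (carrier_face x)"
      using hsub[OF x'(1) s] by blast
    ultimately have "carrier_face (h s x) \<in> K"
      using K(2) down_closedD by metis
    moreover have "(\<Sum>u\<in>V - {w}. max 0 (x u - s * T x)) \<le> sum x (V - {w})"
      by (rule sum_mono) (use x' s T0[OF x'(1)] in auto)
    then have "(\<Sum>u\<in>V - {w}. max 0 (x u - s * T x)) \<le> 1"
      using sumV[of x] x' by (smt (verit))
    then have "\<forall>u. 0 \<le> h s x u" by (auto simp: h_def)
    moreover have "sum (h s x) V = 1"
      using sumV[of "h s x"] sumh by (simp add: h_def)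
    ultimately show ?thesis by (simp add: inK)
  qed
  have h1: "h 1 x \<in> topspace (geometric_realization K')"
    if x: "x \<in> topspace (geometric_realization K)" for x
  proof -
    have x': "\<forall>u. 0 \<le> x u" "carrier_face x \<in> K" "sum x V = 1"
      using x inK by auto
    obtain \<tau> where \<tau>: "\<tau> \<in> K'" "T x = g \<tau> x" using Tatt by blast
    have "carrier_face (h 1 x) - {w} \<subseteq> \<tau>"
    proof
      fix u assume u: "u \<in> carrier_face (h 1 x) - {w}"
      then have "u \<in> V" "u \<noteq> w" "x u > T x"
        by (auto simp: h_def max_def split: if_splits)
      moreover have "x u \<le> g \<tau> x" if "u \<notin> \<tau>"
        unfolding g_def by (rule member_le_sum) (use that x' V \<open>u \<in> V\<close> \<open>u \<noteq> w\<close> in auto)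
      ultimately show "u \<in> \<tau>" using \<tau>(2) by fastforce
    qed
    then have "carrier_face (h 1 x) - {w} \<in> K'"
      using \<tau>(1) K'(2) down_closedD by metis
    moreover have "h 1 x \<in> topspace (geometric_realization K)" using hK[OF x] by simp
    \<comment> \<open>If the carrier were in \<open>K - K'\<close>, removing \<open>w\<close> would
      leave it there by \<open>toggle\<close>; but without \<open>w\<close> it lies in
      \<open>K'\<close>.\<close>
    ultimately show ?thesis
      using toggle[of "carrier_face (h 1 x)"] by (auto simp: inK inK')
  qed
  have contT: "continuous_map X euclideanreal (\<lambda>p. T (k p))"
    if "\<And>u. continuous_map X euclideanreal (\<lambda>p. k p u)" for X :: "'z topology" and k
    unfolding T_def g_def
    by (rule continuous_map_Min) (use finK' K' V that in \<open>auto intro!: continuous_intros\<close>)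
  have conth: "continuous_map (prod_topology (top_of_set {0..1}) (geometric_realization K))
                (geometric_realization K) (\<lambda>p. h (fst p) (snd p))"
  proof (rule continuous_map_into_geometric_realization)
    fix u
    have "continuous_map (prod_topology (top_of_set {0..1}) (geometric_realization K)) euclideanreal
        (\<lambda>p. if u = w then 1 - (\<Sum>u\<in>V - {w}. max 0 (snd p u - fst p * T (snd p)))
                           else if u \<in> V then max 0 (snd p u - fst p * T (snd p)) else 0)"
      by (intro continuous_intros contT) (use V in auto)
    then show "continuous_map (prod_topology (top_of_set {0..1}) (geometric_realization K))
       euclideanreal (\<lambda>p. h (fst p) (snd p) u)" unfolding h_def .
  qed (auto intro: hK)
  have "homotopic_with (\<lambda>x. True) (geometric_realization K) (geometric_realization K) id (h 1)"
    by (subst homotopic_with) (use conth hid in \<open>auto intro!: exI[of _ "\<lambda>p. h (fst p) (snd p)"]\<close>)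
  then have hom: "homotopic_with (\<lambda>x. True) (geometric_realization K) (geometric_realization K) (h 1) id"
    using homotopic_with_sym by blast
  have "continuous_map (geometric_realization K) (geometric_realization K) (h 1)"
    using hom homotopic_with_imp_continuous_maps by blast
  then have "continuous_map (geometric_realization K) (geometric_realization K') (h 1)"
    by (intro continuous_map_into_geometric_realization h1)
       (auto simp: geometric_realization_def continuous_map_in_subtopology continuous_map_componentwise_UNIV)
  moreover have "continuous_map (geometric_realization K') (geometric_realization K) id"
    by (intro continuous_map_into_geometric_realization)
       (use K'(1) inK inK' in \<open>auto intro: continuous_intros\<close>)
  moreover have "h 1 x = x" if "x \<in> topspace (geometric_realization K')" for x
    using that hid Tz K'(1) by (metis inK inK' mult_zero_right subsetD)
  ultimately have "retraction_maps (geometric_realization K) (geometric_realization K') (h 1) id"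
    by (simp add: retraction_maps_def)
  then show ?thesis
    using hom deformation_retract_imp_homotopy_equivalent_space by blast
qed

section \<open>Quotients by contractible subspaces and wedges of spheres\<close>

text \<open>Finitely many closed simplices form a closed subset of the cube over all of
  \<open>UNIV\<close>, which is compact by Tychonoff even if the vertex type is infinite.\<close>

lemma compact_space_geometric_realization:
  fixes V :: "'a set"
  assumes V: "finite V" and K: "K \<subseteq> Pow V" "down_closed K"
  shows "compact_space (geometric_realization K)"
proof -
  define C :: "'a set \<Rightarrow> ('a \<Rightarrow> real) set" where
    "C \<sigma> = {x. (\<forall>u. 0 \<le> x u) \<and> (\<forall>u. u \<notin> \<sigma> \<longrightarrow> x u = 0) \<and> sum x V = 1}" for \<sigma>
  have closedC: "closed (C \<sigma>)" for \<sigma>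
  proof -
    have "closed {x :: 'a \<Rightarrow> real. 0 \<le> x u}" for u
      by (intro closed_Collect_le continuous_intros continuous_on_product_coordinates)
    moreover have "closed {x :: 'a \<Rightarrow> real. u \<notin> \<sigma> \<longrightarrow> x u = 0}" for u
      by (cases "u \<in> \<sigma>") (auto intro!: closed_Collect_eq continuous_intros continuous_on_product_coordinates)
    moreover have "closed {x :: 'a \<Rightarrow> real. sum x V = 1}"
      by (intro closed_Collect_eq continuous_intros continuous_on_product_coordinates)
    ultimately show ?thesis
      unfolding C_def by (intro closed_Collect_conj closed_Collect_all)
  qed
  have fin: "finite K" using assms by (meson finite_Pow_iff finite_subset)
  have C: "x \<in> C \<sigma> \<longleftrightarrow> (\<forall>u. 0 \<le> x u) \<and> carrier_face x \<subseteq> \<sigma> \<and> sum x V = 1" for x \<sigma>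
    by (auto simp: C_def)
  have eq: "topspace (geometric_realization K) = (\<Union>\<sigma>\<in>K. C \<sigma>)"
    using down_closedD[OF K(2)]
    by (auto simp: C topspace_geometric_realization[OF V K(1)])
  have "(\<Union>\<sigma>\<in>K. C \<sigma>) \<subseteq> PiE UNIV (\<lambda>_. {0..1})"
  proof (clarsimp simp: PiE_UNIV_domain)
    fix \<sigma> x u assume \<sigma>: "\<sigma> \<in> K" "x \<in> C \<sigma>"
    then have x: "\<forall>u. 0 \<le> x u" "carrier_face x \<subseteq> V" "sum x V = 1"
      using K(1) by (auto simp: C)
    have "x u \<le> sum x V" if "u \<in> V"
      by (rule member_le_sum) (use x V that in auto)
    moreover have "x u = 0" if "u \<notin> V" using that x(2) by blast
    ultimately show "0 \<le> x u \<and> x u \<le> 1" using x by (cases "u \<in> V") auto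
  qed
  moreover have "compactin (powertop_real UNIV) (PiE UNIV (\<lambda>_. {0..1}))"
    by (simp add: compactin_PiE)
  moreover have "closedin (powertop_real UNIV) (\<Union>\<sigma>\<in>K. C \<sigma>)"
    using closedC fin by (simp add: euclidean_product_topology closed_UN)
  ultimately have "compactin (powertop_real UNIV) (topspace (geometric_realization K))"
    using closed_compactin eq by metis
  then show ?thesis
    by (simp add: compact_space_subtopology geometric_realization_def)
qed

text \<open>The mass outside \<sigma> is continuous and vanishes exactly here. These closed
  simplices are the pieces from which the map to the wedge is later pasted.\<close>

lemma closedin_carrier_face_subset:
  assumes V: "finite V" and K: "K \<subseteq> Pow V"
  shows "closedin (geometric_realization K)
           {x \<in> topspace (geometric_realization K). carrier_face x \<subseteq> \<sigma>}"
proof -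
  have "{x \<in> topspace (geometric_realization K). carrier_face x \<subseteq> \<sigma>} =
        {x \<in> topspace (geometric_realization K). sum x (V - \<sigma>) \<in> {0}}"
  proof -
    have "carrier_face x \<subseteq> \<sigma> \<longleftrightarrow> sum x (V - \<sigma>) = 0"
      if "x \<in> topspace (geometric_realization K)" for x
    proof -
      have x: "\<forall>u. 0 \<le> x u" "carrier_face x \<subseteq> V"
        using that K by (auto simp: topspace_geometric_realization[OF V K])
      then have "sum x (V - \<sigma>) = 0 \<longleftrightarrow> (\<forall>u\<in>V - \<sigma>. x u = 0)"
        using V by (intro sum_nonneg_eq_0_iff) auto
      with x(2) show ?thesis by blast
    qed
    then show ?thesis by blast
  qed
  moreover have "continuous_map (geometric_realization K) euclideanreal (\<lambda>x. sum x (V - \<sigma>))"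
    by (intro continuous_intros) (use V in auto)
  then have "closedin (geometric_realization K)
               {x \<in> topspace (geometric_realization K). sum x (V - \<sigma>) \<in> {0}}"
    by (rule closedin_continuous_map_preimage) simp
  ultimately show ?thesis by simp
qed

text \<open>Collapsing a contractible subspace, with the homotopy extension property replaced by a
  given deformation \<open>h\<close> of all of \<open>X\<close> that moves \<open>A\<close> within
  itself and ends with \<open>A\<close> shrunk to a point. Then \<open>h 1\<close> factors through
  \<open>q\<close>, which gives the homotopy inverse, and \<open>h\<close> itself descends to a
  homotopy on \<open>Y\<close>. Compactness against the Hausdorff property makes both
  \<open>q\<close> and its product with the interval quotient maps.\<close>

lemma homotopy_equivalent_quotient_contractible:
  assumes X: "compact_space X" and Y: "Hausdorff_space Y"
    and q: "continuous_map X Y q" "q ` topspace X = topspace Y"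
    and fib: "\<And>x y. \<lbrakk>x \<in> topspace X; y \<in> topspace X; q x = q y; x \<noteq> y\<rbrakk> \<Longrightarrow> x \<in> A \<and> y \<in> A"
    and A: "\<And>x y. \<lbrakk>x \<in> A; y \<in> A\<rbrakk> \<Longrightarrow> q x = q y"
    and h: "continuous_map (prod_topology (top_of_set {0..1::real}) X) X (\<lambda>p. h (fst p) (snd p))"
    and h0: "\<And>x. x \<in> topspace X \<Longrightarrow> h 0 x = x"
    and hA: "\<And>t x. \<lbrakk>t \<in> {0..1}; x \<in> A\<rbrakk> \<Longrightarrow> h t x \<in> A"
    and h1: "\<And>x y. \<lbrakk>x \<in> A; y \<in> A\<rbrakk> \<Longrightarrow> h 1 x = h 1 y"
  shows "X homotopy_equivalent_space Y"
proof -
  let ?I = "top_of_set {0..1::real}"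
  have qq: "quotient_map X Y q"
    using X Y q continuous_imp_quotient_map by blast
  have "continuous_map X X (h 1)"
    using continuous_map_o_Pair[OF h, of 1] by (simp add: o_def)
  then obtain g where g: "continuous_map Y X g" "\<And>x. x \<in> topspace X \<Longrightarrow> g (q x) = h 1 x"
    using quotient_map_lift_exists[OF qq, of X "h 1"] fib h1 by metis
  have gq: "homotopic_with (\<lambda>x. True) X X id (g \<circ> q)"
    by (subst homotopic_with)
       (use h h0 g(2) in \<open>auto intro!: exI[of _ "\<lambda>p. h (fst p) (snd p)"]\<close>)
  define Q where "Q = (\<lambda>(t::real, x). (t, q x))"
  have "compact_space (prod_topology ?I X)"
    using X by (simp add: compact_space_prod_topology compact_space_subtopology)
  moreover have "Hausdorff_space (prod_topology ?I Y)"
    using Y by (simp add: Hausdorff_space_prod_topology Hausdorff_space_subtopology)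
  moreover have "continuous_map (prod_topology ?I X) (prod_topology ?I Y) Q"
    unfolding Q_def using q(1)
    by (simp add: continuous_map_prod_top)
  moreover have "Q ` topspace (prod_topology ?I X) = topspace (prod_topology ?I Y)"
    using q(2) by (force simp: Q_def)
  ultimately have QQ: "quotient_map (prod_topology ?I X) (prod_topology ?I Y) Q"
    using continuous_imp_quotient_map by blast
  have qh: "continuous_map (prod_topology ?I X) Y (\<lambda>p. q (h (fst p) (snd p)))"
    using continuous_map_compose[OF h q(1)] by (simp add: o_def)
  have "q (h (fst p) (snd p)) = q (h (fst p') (snd p'))"
    if "p \<in> topspace (prod_topology ?I X)" "p' \<in> topspace (prod_topology ?I X)" "Q p = Q p'" for p p'
  proof -
    obtain t x where tx: "p = (t, x)" by (cases p)
    with that(1) have p: "p = (t, x)" "t \<in> {0..1}" "x \<in> topspace X" by auto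
    obtain t' x' where tx': "p' = (t', x')" by (cases p')
    with that(2) have p': "p' = (t', x')" "x' \<in> topspace X" by auto
    have "t' = t" "q x = q x'" using that(3) p p' by (auto simp: Q_def)
    then have "x = x' \<or> x \<in> A \<and> x' \<in> A" using fib p p' by blast
    then show ?thesis using A hA p p' \<open>t' = t\<close> by auto
  qed
  then obtain k where k: "continuous_map (prod_topology ?I Y) Y k"
      "\<And>p. p \<in> topspace (prod_topology ?I X) \<Longrightarrow> k (Q p) = q (h (fst p) (snd p))"
    by (rule quotient_map_lift_exists[OF QQ qh]) blast+
  have k': "k (t, q x) = q (h t x)" if "t \<in> {0..1}" "x \<in> topspace X" for t x
    using k(2)[of "(t, x)"] that by (simp add: Q_def)
  have "k (0, y) = y \<and> k (1, y) = q (g y)" if y: "y \<in> topspace Y" for y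
  proof -
    obtain x where x: "x \<in> topspace X" "y = q x" using y q(2) by blast
    have "k (0, q x) = q x" using k'[of 0 x] h0[OF x(1)] x(1) by simp
    moreover have "k (1, q x) = q (g (q x))" using k'[of 1 x] g(2)[OF x(1)] x(1) by simp
    ultimately show ?thesis using x(2) by simp
  qed
  then have qg: "homotopic_with (\<lambda>x. True) Y Y id (q \<circ> g)"
    by (subst homotopic_with) (use k(1) in auto)
  show ?thesis
    unfolding homotopy_equivalent_space_def
    using q(1) g(1) homotopic_with_symD[OF gq] homotopic_with_symD[OF qg] by blast
qed

lemma continuous_map_from_sum_topology:
  "continuous_map (sum_topology X I) Y f \<longleftrightarrow> (\<forall>i\<in>I. continuous_map (X i) Y (\<lambda>x. f (i, x)))"
proof
  assume R: "\<forall>i\<in>I. continuous_map (X i) Y (\<lambda>x. f (i, x))"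
  have "{x. (i, x) \<in> Sigma I (topspace \<circ> X) \<and> f (i, x) \<in> U} = {x \<in> topspace (X i). f (i, x) \<in> U}"
    if "i \<in> I" for i U
    using that by auto
  with R show "continuous_map (sum_topology X I) Y f"
    by (fastforce simp: continuous_map_def openin_sum_topology)
qed (auto dest: continuous_map_compose[OF continuous_map_component_injection, rotated] simp: o_def)

text \<open>The wedge maps injectively and continuously into a product of lines: block
  \<open>i\<close> of the coordinates of \<Phi> records the point if it lies on sphere
  \<open>i\<close>, and the basepoint otherwise. The Hausdorff property is pulled back along this
  map.\<close>

lemma Hausdorff_space_wedge_of_spheres: "Hausdorff_space (wedge_of_spheres k d)"
proof -
  define \<Phi> :: "(nat \<times> (nat \<Rightarrow> real)) option \<Rightarrow> nat \<times> nat \<Rightarrow> real" where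
    "\<Phi> = (\<lambda>p (i, j). case p of None \<Rightarrow> nsphere_basepoint j
                | Some (i', x) \<Rightarrow> if i = i' then x j else nsphere_basepoint j)"
  let ?S = "sum_topology (\<lambda>_::nat. nsphere d) {0..<k}"
  let ?c = "wedge_collapse (\<lambda>_::nat. nsphere_basepoint)"
  have \<Phi>c: "\<Phi> (?c (i', x)) (i, j) = (if i = i' then x j else nsphere_basepoint j)" for i' x i j
    by (auto simp: \<Phi>_def wedge_collapse_def)
  have "continuous_map ?S (powertop_real UNIV) (\<Phi> \<circ> ?c)"
  proof -
    have "continuous_map (nsphere d) euclideanreal
            (\<lambda>x. if i = i' then x j else nsphere_basepoint j)" for i i' j :: nat
      by (intro continuous_intros continuous_map_nsphere_projection)
    then show ?thesis
      by (auto simp: continuous_map_componentwise_UNIV continuous_map_from_sum_topology \<Phi>c)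
  qed
  from continuous_compose_quotient_map[OF quotient_map_quotient_topology this]
  have "continuous_map (wedge_of_spheres k d) (powertop_real UNIV) \<Phi>"
    by (simp only: wedge_of_spheres_def wedge_sum_def)
  moreover have "inj_on \<Phi> (topspace (wedge_of_spheres k d))"
  proof (rule inj_onI)
    fix p p'
    assume p: "p \<in> topspace (wedge_of_spheres k d)" "p' \<in> topspace (wedge_of_spheres k d)"
      and eq: "\<Phi> p = \<Phi> p'"
    have shape: "p = None \<or> (\<exists>i x. p = Some (i, x) \<and> x \<noteq> nsphere_basepoint)"
      if "p \<in> topspace (wedge_of_spheres k d)" for p
    proof -
      have "p \<in> ?c ` topspace ?S"
        using that by (simp only: wedge_of_spheres_def wedge_sum_def topspace_quotient_topology)
      then obtain i x where "p = ?c (i, x)" by (metis imageE surj_pair)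
      then show ?thesis by (simp add: wedge_collapse_def)
    qed
    have ev: "\<Phi> None (i, j) = nsphere_basepoint j"
      "\<Phi> (Some (i', x)) (i, j) = (if i = i' then x j else nsphere_basepoint j)" for i j i' x
      by (auto simp: \<Phi>_def)
    have e: "\<Phi> p (i, j) = \<Phi> p' (i, j)" for i j using eq by simp
    have Some_None: False
      if "\<And>i j. \<Phi> (Some (i', x)) (i, j) = \<Phi> None (i, j)" "x \<noteq> nsphere_basepoint" for i' x
      using that(2) that(1)[of i'] by (auto simp: ev)
    show "p = p'"
    proof (cases p; cases p')
      fix a b assume ab: "p = Some a" "p' = Some b"
      obtain i x where a: "p = Some (i, x)" "x \<noteq> nsphere_basepoint"
        using shape[OF p(1)] ab by auto
      obtain i' x' where b: "p' = Some (i', x')"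
        using shape[OF p(2)] ab by auto
      have x: "x j = (if i = i' then x' j else nsphere_basepoint j)" for j
        using e[of i j] by (simp add: a b ev)
      have "i = i'"
      proof (rule ccontr)
        assume "i \<noteq> i'"
        then have "x = nsphere_basepoint" using x by auto
        with a(2) show False ..
      qed
      then show "p = p'" using x a b by (auto simp: fun_eq_iff)
    next
      fix a assume "p = None" "p' = Some a"
      then show "p = p'" using Some_None[of "fst a" "snd a"] shape[OF p(2)] e by fastforce
    next
      fix a assume "p = Some a" "p' = None"
      then show "p = p'" using Some_None[of "fst a" "snd a"] shape[OF p(1)] e by fastforce
    qed simp
  qed
  moreover have "Hausdorff_space (powertop_real (UNIV :: (nat \<times> nat) set))"
    by (simp add: Hausdorff_space_product_topology)
  ultimately show ?thesis
    using Hausdorff_space_injective_preimage by blast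
qed

section \<open>A simplex modulo its boundary\<close>

definition simplex_min :: "nat \<Rightarrow> (nat \<Rightarrow> real) \<Rightarrow> real" where
  "simplex_min d y = Min (y ` {..d})"

text \<open>The squared norm of the vector of differences \<open>y i - y 0\<close>; divided by the
  squared minimum it is the squared norm of the point of Euclidean space to which stereographic
  projection is applied.\<close>

definition simplex_skew :: "nat \<Rightarrow> (nat \<Rightarrow> real) \<Rightarrow> real" where
  "simplex_skew d y = (\<Sum>i\<in>{1..d}. (y i - y 0)\<^sup>2)"

text \<open>In the interior of the simplex this is the bijection \<open>y \<mapsto> (y\<^sub>i - y\<^sub>0)\<^sub>i / min y\<close> onto
  \<open>\<real>\<^sup>d\<close>, followed by inverse stereographic projection; clearing denominators extends it
  continuously by the basepoint to the boundary, where the minimum vanishes.\<close>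

definition simplex_to_sphere :: "nat \<Rightarrow> (nat \<Rightarrow> real) \<Rightarrow> nat \<Rightarrow> real" where
  "simplex_to_sphere d y i =
     (if i = 0 then (simplex_skew d y - (simplex_min d y)\<^sup>2) / (simplex_skew d y + (simplex_min d y)\<^sup>2)
      else if i \<le> d then 2 * simplex_min d y * (y i - y 0) / (simplex_skew d y + (simplex_min d y)\<^sup>2)
      else 0)"

definition std_simplex :: "nat \<Rightarrow> (nat \<Rightarrow> real) set" where
  "std_simplex d = {y. (\<forall>i\<le>d. 0 \<le> y i) \<and> sum y {..d} = 1}"

lemma atMost_eq_insert_0: "{..d} = insert 0 {1..d::nat}"
  by auto

lemma simplex_min_le: "i \<le> d \<Longrightarrow> simplex_min d y \<le> y i"
  by (simp add: simplex_min_def)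

lemma simplex_min_attained: "\<exists>i\<le>d. y i = simplex_min d y"
proof -
  have "Min (y ` {..d}) \<in> y ` {..d}" by (intro Min_in) auto
  then obtain i where "i \<le> d" "Min (y ` {..d}) = y i" by (metis atMost_iff imageE)
  then show ?thesis unfolding simplex_min_def by metis
qed

lemma simplex_skew_nonneg: "0 \<le> simplex_skew d y"
  by (simp add: simplex_skew_def sum_nonneg)

text \<open>Skew 0 makes all coordinates equal and minimum 0 makes one of them vanish; together they
  force \<open>y\<close> to be zero, against sum 1.\<close>

lemma simplex_denominator_pos:
  assumes y: "y \<in> std_simplex d"
  shows "0 < simplex_skew d y + (simplex_min d y)\<^sup>2"
proof (rule ccontr)
  assume "\<not> ?thesis"
  then have 0: "simplex_skew d y = 0" "(simplex_min d y)\<^sup>2 = 0"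
    using simplex_skew_nonneg[of d y] zero_le_power2[of "simplex_min d y"] by linarith+
  then have "y i = y 0" if "i \<le> d" for i
    using that by (cases "i = 0") (auto simp: simplex_skew_def sum_nonneg_eq_0_iff)
  moreover obtain j where "j \<le> d" "y j = 0"
    using simplex_min_attained[of d y] 0(2) by auto
  ultimately have "y i = 0" if "i \<le> d" for i using that by metis
  then have "sum y {..d} = 0" by simp
  then show False using y by (simp add: std_simplex_def)
qed

lemma simplex_to_sphere_in_nsphere:
  assumes y: "y \<in> std_simplex d"
  shows "simplex_to_sphere d y \<in> topspace (nsphere d)"
proof -
  define m A where "m = simplex_min d y" and "A = simplex_skew d y"
  have D: "A + m\<^sup>2 \<noteq> 0" using simplex_denominator_pos[OF y] by (simp add: m_def A_def)
  have "(\<Sum>i\<in>{1..d}. (simplex_to_sphere d y i)\<^sup>2) =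
        (\<Sum>i\<in>{1..d}. (2 * m / (A + m\<^sup>2))\<^sup>2 * (y i - y 0)\<^sup>2)"
    by (rule sum.cong)
       (auto simp: simplex_to_sphere_def m_def A_def power_mult_distrib power_divide)
  also have "\<dots> = (2 * m / (A + m\<^sup>2))\<^sup>2 * A"
    by (simp add: A_def simplex_skew_def sum_distrib_left)
  finally have "(\<Sum>i\<le>d. (simplex_to_sphere d y i)\<^sup>2) = ((A - m\<^sup>2) / (A + m\<^sup>2))\<^sup>2 + (2 * m / (A + m\<^sup>2))\<^sup>2 * A"
    unfolding atMost_eq_insert_0
    by (subst sum.insert) (auto simp: simplex_to_sphere_def m_def A_def)
  also have "\<dots> = ((A - m\<^sup>2)\<^sup>2 + 4 * m\<^sup>2 * A) / (A + m\<^sup>2)\<^sup>2"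
    by (simp add: power_divide power_mult_distrib add_divide_distrib)
  also have "(A - m\<^sup>2)\<^sup>2 + 4 * m\<^sup>2 * A = (A + m\<^sup>2)\<^sup>2"
    by (simp add: power2_eq_square algebra_simps)
  also have "(A + m\<^sup>2)\<^sup>2 / (A + m\<^sup>2)\<^sup>2 = 1" using D by simp
  finally show ?thesis
    by (simp add: nsphere simplex_to_sphere_def)
qed

lemma simplex_to_sphere_eq_basepoint_iff:
  assumes y: "y \<in> std_simplex d"
  shows "simplex_to_sphere d y = nsphere_basepoint \<longleftrightarrow> simplex_min d y = 0"
proof
  assume "simplex_to_sphere d y = nsphere_basepoint"
  then have "simplex_to_sphere d y 0 = 1" by (simp add: nsphere_basepoint_def)
  then show "simplex_min d y = 0"
    using simplex_denominator_pos[OF y] by (simp add: simplex_to_sphere_def divide_simps split: if_splits)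
next
  assume m: "simplex_min d y = 0"
  then have "simplex_skew d y \<noteq> 0" using simplex_denominator_pos[OF y] by simp
  with m show "simplex_to_sphere d y = nsphere_basepoint"
    by (auto simp: fun_eq_iff simplex_to_sphere_def nsphere_basepoint_def)
qed

lemma simplex_to_sphere_stereographic:
  assumes y: "y \<in> std_simplex d" and m: "0 < simplex_min d y" and i: "1 \<le> i" "i \<le> d"
  shows "(y i - y 0) / simplex_min d y = simplex_to_sphere d y i / (1 - simplex_to_sphere d y 0)"
proof -
  define m A where "m = simplex_min d y" and "A = simplex_skew d y"
  have D: "A + m\<^sup>2 > 0" using simplex_denominator_pos[OF y] by (simp add: m_def A_def)
  have m: "m > 0" using m by (simp add: m_def)
  have "1 - simplex_to_sphere d y 0 = 2 * m\<^sup>2 / (A + m\<^sup>2)"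
    using D by (simp add: simplex_to_sphere_def field_simps flip: m_def A_def)
  moreover have "simplex_to_sphere d y i = 2 * m * (y i - y 0) / (A + m\<^sup>2)"
    using i by (simp add: simplex_to_sphere_def m_def A_def)
  ultimately show ?thesis
    using D m by (simp add: power2_eq_square flip: m_def)
qed

text \<open>Rescale so that the minimum is 1. The stereographic coordinates give all differences to
  coordinate 0, hence the rescaled point up to a common shift; the minimum fixes the shift, and the
  sum 1 of the original point fixes the scale.\<close>

lemma simplex_to_sphere_inj:
  assumes y: "y \<in> std_simplex d" "0 < simplex_min d y"
    and y': "y' \<in> std_simplex d" "0 < simplex_min d y'"
    and eq: "simplex_to_sphere d y = simplex_to_sphere d y'" and i: "i \<le> d"
  shows "y i = y' i"
proof -
  define g where "g y i = y i / simplex_min d y" for y i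
  have diff: "g y i - g y 0 = g y' i - g y' 0" if "i \<le> d" for i
    using simplex_to_sphere_stereographic[OF y, of i] simplex_to_sphere_stereographic[OF y', of i]
      eq that by (cases "i = 0") (auto simp: g_def diff_divide_distrib)
  have g1: "1 \<le> g z i" if "0 < simplex_min d z" "i \<le> d" for z i
    using that simplex_min_le[of i d z] by (simp add: g_def)
  have g2: "\<exists>i\<le>d. g z i = 1" if "0 < simplex_min d z" for z
    using simplex_min_attained[of d z] that by (force simp: g_def)
  obtain a b where ab: "a \<le> d" "g y a = 1" "b \<le> d" "g y' b = 1"
    using g2[OF y(2)] g2[OF y'(2)] by auto
  have "g y 0 = g y' 0"
    using diff[OF ab(1)] diff[OF ab(3)] g1[OF y(2) ab(3)] g1[OF y'(2) ab(1)] ab by linarith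
  then have gg: "g y i = g y' i" if "i \<le> d" for i using diff[OF that] by simp
  have s: "sum (g z) {..d} = 1 / simplex_min d z" if "z \<in> std_simplex d" for z
    using that by (simp add: g_def std_simplex_def flip: sum_divide_distrib)
  have "sum (g y) {..d} = sum (g y') {..d}" using gg by (intro sum.cong) auto
  then have "simplex_min d y = simplex_min d y'" using s y(1) y'(1) by simp
  then show ?thesis using gg[OF i] y(2) by (simp add: g_def)
qed

lemma simplex_to_sphere_surj:
  assumes p: "p \<in> topspace (nsphere d)" "p \<noteq> nsphere_basepoint"
  obtains y where "y \<in> std_simplex d" "0 < simplex_min d y" "simplex_to_sphere d y = p"
proof -
  have p1: "(\<Sum>i\<le>d. (p i)\<^sup>2) = 1" and p2: "\<And>i. i > d \<Longrightarrow> p i = 0"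
    using p(1) by (auto simp: nsphere)
  define q where "q = (\<Sum>i\<in>{1..d}. (p i)\<^sup>2)"
  have q: "(p 0)\<^sup>2 + q = 1"
    using p1 unfolding atMost_eq_insert_0 q_def by (subst (asm) sum.insert) auto
  have q0: "0 \<le> q" by (simp add: q_def sum_nonneg)
  have p0: "p 0 < 1"
  proof (rule ccontr)
    assume "\<not> p 0 < 1"
    then have "(p 0)\<^sup>2 \<ge> 1" by (simp add: one_le_power)
    then have "q = 0" "(p 0)\<^sup>2 = 1" using q q0 by auto
    then have "p 0 = 1" "\<And>i. 1 \<le> i \<Longrightarrow> i \<le> d \<Longrightarrow> p i = 0"
      using \<open>\<not> p 0 < 1\<close> by (auto simp: q_def sum_nonneg_eq_0_iff power2_eq_1_iff)
    then have "p = nsphere_basepoint"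
      using p2 by (auto simp: fun_eq_iff nsphere_basepoint_def not_less_eq_eq) (metis One_nat_def Suc_leI not_le)
    then show False using p(2) by simp
  qed
  \<comment> \<open>The injectivity argument run backwards: \<open>z\<close> is the stereographic
    projection of \<open>p\<close> from the basepoint, with a 0 for coordinate 0 because only
    differences are determined. Shifting to minimum 1 gives \<open>g\<close>, and dividing by the
    sum \<open>G\<close> gives a point of the simplex with minimum \<open>1 / G\<close>.\<close>
  define z where "z i = (if i = 0 then 0 else p i / (1 - p 0))" for i
  define g where "g i = z i - simplex_min d z + 1" for i
  define G where "G = sum g {..d}"
  define y where "y i = g i / G" for i
  have g1: "1 \<le> g i" if "i \<le> d" for i using simplex_min_le[OF that, of z] by (simp add: g_def)
  have "g 0 \<le> G" unfolding G_def by (rule member_le_sum) (use g1 in \<open>auto intro: order_trans[OF zero_le_one]\<close>)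
  then have G: "1 \<le> G" using g1[of 0] by simp
  have y: "y \<in> std_simplex d"
    using G g1 by (auto simp: std_simplex_def y_def G_def simp flip: sum_divide_distrib
        intro!: divide_nonneg_nonneg intro: order_trans[OF zero_le_one])
  have ymin: "simplex_min d y = 1 / G"
  proof -
    obtain a where a: "a \<le> d" "z a = simplex_min d z" using simplex_min_attained by blast
    then have "y a = 1 / G" by (simp add: y_def g_def)
    then have "simplex_min d y \<le> 1 / G" using simplex_min_le[OF a(1), of y] by simp
    moreover obtain b where b: "b \<le> d" "y b = simplex_min d y" using simplex_min_attained by blast
    then have "1 / G \<le> simplex_min d y" using g1[OF b(1)] G by (simp add: y_def divide_right_mono flip: b(2))
    ultimately show ?thesis by simp
  qed
  have yd: "y i - y 0 = z i / G" for i
    by (simp add: y_def g_def z_def diff_divide_distrib add_divide_distrib)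
  have skew: "simplex_skew d y = q / ((1 - p 0)\<^sup>2 * G\<^sup>2)"
  proof -
    have "simplex_skew d y = (\<Sum>i\<in>{1..d}. (p i)\<^sup>2 / ((1 - p 0)\<^sup>2 * G\<^sup>2))"
      unfolding simplex_skew_def yd
      by (rule sum.cong) (auto simp: z_def power_divide power_mult_distrib)
    then show ?thesis by (simp add: q_def sum_divide_distrib)
  qed
  define r where "r = 1 - p 0"
  have r: "r > 0" "p 0 = 1 - r" "q = 2 * r - r\<^sup>2"
    using p0 q by (auto simp: r_def power2_eq_square algebra_simps)
  have A: "simplex_skew d y = (2 - r) / (r * G\<^sup>2)"
    using r(1) G unfolding skew r(3) r_def[symmetric]
    by (simp add: power2_eq_square field_simps)
  have D: "simplex_skew d y + (simplex_min d y)\<^sup>2 = 2 / (r * G\<^sup>2)"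
    using r(1) G unfolding A ymin by (simp add: power_divide field_simps power2_eq_square)
  have N: "simplex_skew d y - (simplex_min d y)\<^sup>2 = (2 - 2 * r) / (r * G\<^sup>2)"
    using r(1) G unfolding A ymin by (simp add: power_divide field_simps power2_eq_square)
  have "simplex_to_sphere d y i = p i" for i
  proof (cases "i = 0 \<or> i > d")
    case True
    then show ?thesis
      using r G p2[of i] by (auto simp: simplex_to_sphere_def D N)
  next
    case False
    then have "simplex_to_sphere d y i = 2 * simplex_min d y * (y i - y 0) / (simplex_skew d y + (simplex_min d y)\<^sup>2)"
      by (simp add: simplex_to_sphere_def)
    also have "\<dots> = 2 * (1 / G) * (z i / G) / (2 / (r * G\<^sup>2))"
      unfolding D by (simp only: ymin yd)
    also have "\<dots> = z i * r" using r(1) G by (simp add: power2_eq_square field_simps)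
    also have "\<dots> = p i" using r(1) False by (simp add: z_def r_def)
    finally show ?thesis .
  qed
  then have "simplex_to_sphere d y = p" by auto
  then show ?thesis using that y ymin G by simp
qed

lemma continuous_map_simplex_to_sphere:
  assumes f: "\<And>i. i \<le> d \<Longrightarrow> continuous_map X euclideanreal (\<lambda>x. f x i)"
    and simplex: "\<And>x. x \<in> topspace X \<Longrightarrow> f x \<in> std_simplex d"
  shows "continuous_map X (nsphere d) (\<lambda>x. simplex_to_sphere d (f x))"
proof -
  have m: "continuous_map X euclideanreal (\<lambda>x. simplex_min d (f x))"
    unfolding simplex_min_def by (rule continuous_map_Min) (use f in auto)
  have A: "continuous_map X euclideanreal (\<lambda>x. simplex_skew d (f x))"
    unfolding simplex_skew_def by (intro continuous_intros f) auto
  have D: "simplex_skew d (f x) + (simplex_min d (f x))\<^sup>2 \<noteq> 0" if "x \<in> topspace X" for x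
    using simplex_denominator_pos[OF simplex[OF that]] by simp
  have "continuous_map X euclideanreal (\<lambda>x. simplex_to_sphere d (f x) i)" for i
    unfolding simplex_to_sphere_def
    by (intro continuous_intros f m A D) auto
  moreover have "(\<lambda>x. simplex_to_sphere d (f x)) \<in> topspace X \<rightarrow>
      {x. (\<Sum>i\<le>d. (x i)\<^sup>2) = 1 \<and> (\<forall>i>d. x i = 0)}"
    using simplex_to_sphere_in_nsphere[OF simplex] by (auto simp: nsphere)
  ultimately show ?thesis
    by (simp add: nsphere continuous_map_in_subtopology continuous_map_componentwise_UNIV)
qed

section \<open>Cones with attached cells\<close>

text \<open>Since \<open>|L|\<close> is contractible, \<open>|K|\<close> is homotopy equivalent to \<open>|K|/|L|\<close>, in which every
  cell becomes a sphere.\<close>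

locale cone_with_cells =
  fixes V :: "'a set" and K L :: "'a set set" and v :: 'a and d :: nat
  assumes V: "finite V" and K: "K \<subseteq> Pow V" "down_closed K"
    and L: "L \<subseteq> K" "down_closed L" "L \<noteq> {}"
    and cone: "\<And>\<sigma>. \<sigma> \<in> L \<Longrightarrow> insert v \<sigma> \<in> L"
    and cells: "\<And>\<sigma>. \<sigma> \<in> K - L \<Longrightarrow> card \<sigma> = Suc d"
begin

abbreviation "X \<equiv> geometric_realization K"
abbreviation "F \<equiv> K - L"

lemma finite_F: "finite F"
  using V K(1) by (meson finite_Diff finite_Pow_iff finite_subset)

lemma in_X: "x \<in> topspace X \<longleftrightarrow> (\<forall>u. 0 \<le> x u) \<and> carrier_face x \<in> K \<and> sum x V = 1"
  by (rule topspace_geometric_realization[OF V K(1)])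

lemma v_in_L: "{v} \<in> L"
  using L cone down_closedD by (metis empty_subsetI ex_in_conv)

lemma v_in_V: "v \<in> V"
  using v_in_L L(1) K(1) by auto

lemma cell: "\<sigma> \<in> F \<Longrightarrow> finite \<sigma> \<and> \<sigma> \<noteq> {} \<and> \<sigma> \<subseteq> V"
  using cells V K(1) by (metis Diff_iff PowD card.empty finite_subset nat.distinct(1) subsetD)

text \<open>All cells have the same number of vertices, so none properly contains another; every
  cell is attached along \<open>L\<close> alone.\<close>

lemma proper_face:
  assumes "\<sigma> \<in> F" "\<tau> \<subset> \<sigma>"
  shows "\<tau> \<in> L"
proof (rule ccontr)
  assume "\<tau> \<notin> L"
  moreover have "\<tau> \<in> K" using down_closedD[OF K(2), of \<sigma> \<tau>] assms by auto
  ultimately have "card \<tau> = card \<sigma>" using assms(1) cells by simp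
  moreover have "card \<tau> < card \<sigma>" using cell[OF assms(1)] assms(2) psubset_card_mono by blast
  ultimately show False by simp
qed

text \<open>Otherwise \<sigma> without \<open>v\<close> is a proper face, hence in \<open>L\<close>,
  and the cone property puts \<sigma> back into \<open>L\<close>.\<close>

lemma v_notin_cell: "\<sigma> \<in> F \<Longrightarrow> v \<notin> \<sigma>"
proof
  assume \<sigma>: "\<sigma> \<in> F" "v \<in> \<sigma>"
  then have "\<sigma> - {v} \<in> L" by (intro proper_face) auto
  then show False using cone[of "\<sigma> - {v}"] \<sigma> by (simp add: insert_absorb)
qed

lemma cell_maximal:
  assumes "\<sigma> \<in> F" "\<tau> \<in> K" "\<sigma> \<subseteq> \<tau>"
  shows "\<tau> = \<sigma>"
proof (rule ccontr)
  assume "\<tau> \<noteq> \<sigma>"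
  have "\<tau> \<in> F" using assms L(2) down_closedD by blast
  then show False using proper_face[of \<tau> \<sigma>] assms \<open>\<tau> \<noteq> \<sigma>\<close> by auto
qed

section \<open>Depth functions of the cells and the deformation that contracts
  \<open>L\<close>\<close>

definition cell_min :: "'a set \<Rightarrow> ('a \<Rightarrow> real) \<Rightarrow> real" where
  "cell_min \<sigma> x = Min (x ` \<sigma>)"

lemma cell_min_le: "\<lbrakk>\<sigma> \<in> F; u \<in> \<sigma>\<rbrakk> \<Longrightarrow> cell_min \<sigma> x \<le> x u"
  using cell by (simp add: cell_min_def)

lemma cell_min_attained: "\<sigma> \<in> F \<Longrightarrow> \<exists>u\<in>\<sigma>. x u = cell_min \<sigma> x"
proof -
  assume "\<sigma> \<in> F"
  then have "Min (x ` \<sigma>) \<in> x ` \<sigma>" using cell[of \<sigma>] by (intro Min_in) auto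
  then show ?thesis unfolding cell_min_def by (metis imageE)
qed

lemma cell_min_eq_0:
  assumes "x \<in> topspace X" "\<sigma> \<in> F" "carrier_face x \<noteq> \<sigma>"
  shows "cell_min \<sigma> x = 0"
proof -
  have "\<not> \<sigma> \<subseteq> carrier_face x" using cell_maximal assms in_X by blast
  then obtain u where "u \<in> \<sigma>" "x u = 0" by auto
  then have "cell_min \<sigma> x \<le> 0" using cell_min_le[OF assms(2), of u x] by simp
  moreover obtain w where "x w = cell_min \<sigma> x" using cell_min_attained[OF assms(2), of x] by blast
  then have "0 \<le> cell_min \<sigma> x" using assms(1) in_X by metis
  ultimately show ?thesis by simp
qed

lemma cell_min_pos:
  assumes "x \<in> topspace X" "carrier_face x \<in> F"
  shows "0 < cell_min (carrier_face x) x"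
proof -
  obtain u where "u \<in> carrier_face x" "x u = cell_min (carrier_face x) x"
    using cell_min_attained[OF assms(2), of x] by blast
  moreover have "0 \<le> x u" using assms(1) in_X by blast
  ultimately show ?thesis by simp
qed

text \<open>At any point at most one depth is nonzero, so a sum over all cells selects the cell that
  carries the point. This is what allows \<open>push\<close> to be a single formula, continuous
  without any pasting.\<close>

lemma sum_cells:
  assumes x: "x \<in> topspace X" "carrier_face x \<in> F" and g: "g 0 = 0"
    and S: "S \<subseteq> F"
  shows "(\<Sum>\<sigma>\<in>S. g (cell_min \<sigma> x)) = (if carrier_face x \<in> S then g (cell_min (carrier_face x) x) else (0::real))"
proof -
  have "(\<Sum>\<sigma>\<in>S. g (cell_min \<sigma> x)) = (\<Sum>\<sigma>\<in>S. if \<sigma> = carrier_face x then g (cell_min (carrier_face x) x) else 0)"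
  proof (rule sum.cong)
    fix \<sigma> assume "\<sigma> \<in> S"
    then have "\<sigma> \<in> F" using S by blast
    then show "g (cell_min \<sigma> x) = (if \<sigma> = carrier_face x then g (cell_min (carrier_face x) x) else 0)"
      using cell_min_eq_0[OF x(1), of \<sigma>] g by (cases "carrier_face x = \<sigma>") simp_all
  qed simp
  then show ?thesis using finite_subset[OF S finite_F] by simp
qed

lemma sum_cells_L:
  assumes x: "x \<in> topspace X" "carrier_face x \<in> L" and g: "g 0 = (0::real)" and S: "S \<subseteq> F"
  shows "(\<Sum>\<sigma>\<in>S. g (cell_min \<sigma> x)) = 0"
proof (rule sum.neutral, rule ballI)
  fix \<sigma> assume "\<sigma> \<in> S"
  then have "\<sigma> \<in> F" "carrier_face x \<noteq> \<sigma>" using x(2) S by blast+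
  then show "g (cell_min \<sigma> x) = 0" using cell_min_eq_0[OF x(1)] g by metis
qed

definition C :: real where "C = 2 * (real d + 1)"

text \<open>On \<open>L\<close> this is the straight-line contraction to \<open>v\<close>. On a cell \<open>\<sigma>\<close>, whose depth function is
  the minimum of the coordinates, the collar of depth \<open>t / C\<close> is pushed onto the cone over the
  boundary of \<open>\<sigma>\<close>, while the remaining part is stretched to all of \<open>\<sigma>\<close>. Because \<open>C > d + 1\<close>,
  the barycentre, of depth \<open>1 / (d + 1)\<close>, is never on the border between the two parts; this keeps
  \<open>push\<close> away from 0, so that it can be normalised.\<close>

definition push :: "real \<Rightarrow> ('a \<Rightarrow> real) \<Rightarrow> 'a \<Rightarrow> real" where
  "push t x u =
     (if u \<in> V then
        (1 - t + t * (C * (\<Sum>\<sigma>\<in>F. cell_min \<sigma> x))) * (x u - (\<Sum>\<sigma>\<in>{\<sigma> \<in> F. u \<in> \<sigma>}. cell_min \<sigma> x))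
        + (\<Sum>\<sigma>\<in>{\<sigma> \<in> F. u \<in> \<sigma>}. max 0 (cell_min \<sigma> x - t / C))
        + (if u = v then max 0 (t - C * (\<Sum>\<sigma>\<in>F. cell_min \<sigma> x)) else 0)
      else 0)"

lemma C_pos: "0 < C" by (simp add: C_def)

lemma push_L:
  assumes x: "x \<in> topspace X" "carrier_face x \<in> L" and t: "0 \<le> t"
  shows "push t x u = (1 - t) * x u + (if u = v then t else 0)"
proof -
  have "x u = 0" if "u \<notin> V" using that x K in_X by auto
  moreover have "(\<Sum>\<sigma>\<in>F. cell_min \<sigma> x) = 0" "(\<Sum>\<sigma>\<in>{\<sigma> \<in> F. u \<in> \<sigma>}. cell_min \<sigma> x) = 0"
    using sum_cells_L[OF x, of "\<lambda>a. a" F] sum_cells_L[OF x, of "\<lambda>a. a" "{\<sigma> \<in> F. u \<in> \<sigma>}"]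
    by blast+
  moreover have "(\<Sum>\<sigma>\<in>{\<sigma> \<in> F. u \<in> \<sigma>}. max 0 (cell_min \<sigma> x - t / C)) = 0"
    by (rule sum_cells_L[OF x, of "\<lambda>a. max 0 (a - t / C)"]) (use t C_pos in auto)
  ultimately show ?thesis using t v_in_V by (auto simp: push_def)
qed

text \<open>With m the depth of \<open>x\<close> in its cell, \<open>x\<close> splits into the
  constant part m on \<sigma> and the remainder \<open>x - m\<close>, whose carrier is a proper
  face. Where \<open>C * m < t\<close> the constant part is gone and \<open>v\<close> has weight;
  where \<open>C * m > t\<close> the vertex \<open>v\<close> has none. As m tends to 0 the factor of
  the remainder tends to \<open>1 - t\<close> and the weight of \<open>v\<close> to
  \<open>t\<close>, in agreement with \<open>push_L\<close>.\<close>

lemma push_cell: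
  assumes x: "x \<in> topspace X" "carrier_face x = \<sigma>" "\<sigma> \<in> F" and t: "0 \<le> t"
  shows "push t x u =
     (if u \<in> \<sigma> then (1 - t + t * (C * cell_min \<sigma> x)) * (x u - cell_min \<sigma> x) + max 0 (cell_min \<sigma> x - t / C)
      else if u = v then max 0 (t - C * cell_min \<sigma> x) else 0)"
proof -
  have \<sigma>: "\<sigma> \<subseteq> V" "v \<notin> \<sigma>" using x cell v_notin_cell by auto
  have x0: "x u = 0" if "u \<notin> \<sigma>" using that x by auto
  have xF: "carrier_face x \<in> F" using x by simp
  have sub: "{\<sigma> \<in> F. u \<in> \<sigma>} \<subseteq> F" by blast
  have "(\<Sum>\<sigma>\<in>F. cell_min \<sigma> x) = cell_min \<sigma> x"
       "(\<Sum>\<sigma>\<in>{\<sigma> \<in> F. u \<in> \<sigma>}. cell_min \<sigma> x) = (if u \<in> \<sigma> then cell_min \<sigma> x else 0)"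
    using sum_cells[OF x(1) xF, of "\<lambda>a. a" F]
      sum_cells[OF x(1) xF, of "\<lambda>a. a" "{\<sigma> \<in> F. u \<in> \<sigma>}", OF _ sub] x(2,3) by auto
  moreover have "(\<Sum>\<sigma>\<in>{\<sigma> \<in> F. u \<in> \<sigma>}. max 0 (cell_min \<sigma> x - t / C)) =
                 (if u \<in> \<sigma> then max 0 (cell_min \<sigma> x - t / C) else 0)"
    using sum_cells[OF x(1) xF, of "\<lambda>a. max 0 (a - t / C)" "{\<sigma> \<in> F. u \<in> \<sigma>}", OF _ sub] x(2,3) t C_pos
    by auto
  ultimately show ?thesis
    using \<sigma> x0 v_in_V by (auto simp: push_def)
qed

lemma push_facts:
  assumes x: "x \<in> topspace X" and t: "0 \<le> t" "t \<le> 1"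
  shows "\<forall>u. 0 \<le> push t x u" "carrier_face (push t x) \<in> K" "0 < sum (push t x) V"
proof -
  have x': "\<forall>u. 0 \<le> x u" "carrier_face x \<in> K" "sum x V = 1" using x in_X by auto
  have "(\<forall>u. 0 \<le> push t x u) \<and> carrier_face (push t x) \<in> K \<and> 0 < sum (push t x) V"
  proof (cases "carrier_face x \<in> L")
    case True
    note p = push_L[OF x True t(1)]
    have "carrier_face (push t x) \<subseteq> insert v (carrier_face x)" by (auto simp: p)
    then have "carrier_face (push t x) \<in> K"
      using cone[OF True] L(1) K(2) down_closedD by blast
    moreover have "sum (push t x) V = 1"
      using x'(3) V v_in_V by (simp add: p sum.distrib flip: sum_distrib_left)
    ultimately show ?thesis using x' t by (simp add: p)
  next
    case False
    define \<sigma> m where "\<sigma> = carrier_face x" and "m = cell_min \<sigma> x"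
    have \<sigma>: "\<sigma> \<in> F" using False x' by (simp add: \<sigma>_def)
    note p = push_cell[OF x \<sigma>_def[symmetric] \<sigma> t(1), folded m_def]
    have m: "0 < m" using cell_min_pos[OF x] \<sigma> by (simp add: \<sigma>_def m_def)
    have mle: "m \<le> x u" if "u \<in> \<sigma>" for u using cell_min_le[OF \<sigma> that] by (simp add: m_def)
    have fac: "0 \<le> 1 - t + t * (C * m)" using t m C_pos by simp
    have nn: "\<forall>u. 0 \<le> push t x u" using mle fac by (auto simp: p)
    have v: "v \<notin> \<sigma>" using v_notin_cell[OF \<sigma>] .
    have sub: "carrier_face (push t x) \<in> K"
    proof (cases "t \<le> C * m")
      case True
      then have "carrier_face (push t x) \<subseteq> \<sigma>" by (auto simp: p split: if_splits)
      then show ?thesis using \<sigma> K(2) down_closedD by blast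
    next
      case False
      \<comment> \<open>In the collar a vertex with minimal coordinate receives weight 0, so the
        carrier consists of \<open>v\<close> and a proper face of \<sigma>, and such sets belong to
        the cone \<open>L\<close>.\<close>
      obtain a where a: "a \<in> \<sigma>" "x a = m"
        using cell_min_attained[OF \<sigma>] by (auto simp: m_def)
      have "push t x a = 0" using False a C_pos by (simp add: p field_simps)
      then have "carrier_face (push t x) \<subseteq> insert v (\<sigma> - {a})" by (auto simp: p split: if_splits)
      moreover have "insert v (\<sigma> - {a}) \<in> L" using a proper_face[OF \<sigma>] cone by blast
      ultimately show ?thesis using L(1) K(2) down_closedD by blast
    qed
    have "\<exists>u\<in>V. 0 < push t x u"
    proof (rule linorder_cases[of t "C * m"])
      assume "t < C * m"
      then have "0 < m - t / C" using C_pos by (simp add: field_simps)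
      moreover obtain a where a: "a \<in> \<sigma>" using cell[OF \<sigma>] by auto
      moreover have "0 \<le> (1 - t + t * (C * m)) * (x a - m)" using fac mle[OF a] by simp
      ultimately have "0 < push t x a" by (simp add: p)
      then show ?thesis using a cell[OF \<sigma>] by blast
    next
      assume "C * m < t"
      then show ?thesis using v v_in_V by (auto simp: p)
    next
      \<comment> \<open>On the border both maxima vanish and only the remainder can be positive. It
        is zero at the barycentre alone, where \<open>C * m = 2\<close>; this would make
        \<open>t\<close> exceed 1.\<close>
      assume tm: "t = C * m"
      have "\<exists>u\<in>\<sigma>. m < x u"
      proof (rule ccontr)
        assume "\<not> ?thesis"
        then have "x u = m" if "u \<in> \<sigma>" for u using mle that by (meson antisym not_le)
        moreover have "sum x V = sum x \<sigma>"
          by (rule sum.mono_neutral_right) (use cell[OF \<sigma>] V in \<open>auto simp: \<sigma>_def\<close>)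
        ultimately have "1 = real (card \<sigma>) * m" using x'(3) by simp
        then have "2 = C * m" using cells[OF \<sigma>] by (simp add: C_def algebra_simps)
        then show False using tm t by simp
      qed
      then obtain u where u: "u \<in> \<sigma>" "m < x u" by blast
      have "0 < 1 - t + t * (C * m)"
      proof (cases "t = 1")
        case False
        then show ?thesis using t m C_pos by (smt (verit) mult_nonneg_nonneg)
      qed (use tm in simp)
      then have "0 < (1 - t + t * (C * m)) * (x u - m)" using u by simp
      then have "0 < push t x u" using u(1) by (simp add: p add_pos_nonneg)
      then show ?thesis using u cell[OF \<sigma>] by blast
    qed
    then have "0 < sum (push t x) V"
      using nn V by (meson sum_pos2)
    then show ?thesis using nn sub by simp
  qed
  then show "\<forall>u. 0 \<le> push t x u" "carrier_face (push t x) \<in> K" "0 < sum (push t x) V" by auto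
qed

definition retract :: "real \<Rightarrow> ('a \<Rightarrow> real) \<Rightarrow> 'a \<Rightarrow> real" where
  "retract t x u = push t x u / sum (push t x) V"

lemma retract_in_X:
  assumes x: "x \<in> topspace X" and t: "0 \<le> t" "t \<le> 1"
  shows "retract t x \<in> topspace X"
proof -
  note p = push_facts[OF x t]
  have "carrier_face (retract t x) = carrier_face (push t x)"
    using p(3) by (auto simp: retract_def)
  then show ?thesis
    using p by (simp add: in_X) (simp add: retract_def flip: sum_divide_distrib)
qed

text \<open>On \<open>L\<close> the total weight of \<open>push\<close> is already
  \<open>(1 - t) + t = 1\<close>, so the normalisation leaves the straight-line contraction
  intact.\<close>

lemma retract_L:
  assumes x: "x \<in> topspace X" "carrier_face x \<in> L" and t: "0 \<le> t" "t \<le> 1"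
  shows "retract t x = (\<lambda>u. (1 - t) * x u + (if u = v then t else 0))"
proof -
  note p = push_L[OF x t(1)]
  have "sum (push t x) V = 1"
    using x(1) V v_in_V by (simp add: p sum.distrib in_X flip: sum_distrib_left)
  then show ?thesis by (auto simp: retract_def p)
qed

lemma retract_0:
  assumes x: "x \<in> topspace X"
  shows "retract 0 x = x"
proof -
  have "push 0 x = x"
  proof (cases "carrier_face x \<in> L")
    case True
    then show ?thesis using push_L[OF x True] by auto
  next
    case False
    then have \<sigma>: "carrier_face x \<in> F" using x in_X by simp
    have m: "0 < cell_min (carrier_face x) x" using cell_min_pos[OF x \<sigma>] .
    then have "0 < C * cell_min (carrier_face x) x" using C_pos by simp
    with m show ?thesis
      using push_cell[OF x refl \<sigma>, of 0] v_notin_cell[OF \<sigma>]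
      by (auto simp: fun_eq_iff max_def)
  qed
  then show ?thesis using x by (simp add: retract_def in_X fun_eq_iff)
qed

lemma continuous_map_retract:
  "continuous_map (prod_topology (top_of_set {0..1}) X) X (\<lambda>p. retract (fst p) (snd p))"
proof (rule continuous_map_into_geometric_realization)
  let ?P = "prod_topology (top_of_set {0..1::real}) X"
  have m: "continuous_map ?P euclideanreal (\<lambda>p. cell_min \<sigma> (snd p))" if "\<sigma> \<in> F" for \<sigma>
    unfolding cell_min_def
    by (rule continuous_map_Min) (use cell[OF that] in \<open>auto intro: continuous_intros\<close>)
  have p: "continuous_map ?P euclideanreal (\<lambda>p. push (fst p) (snd p) u)" for u
    unfolding push_def
    by (intro continuous_intros m)
       (use finite_F C_pos finite_subset[OF _ finite_F, of "{\<sigma> \<in> F. u \<in> \<sigma>}"] in auto)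
  show "continuous_map ?P euclideanreal (\<lambda>p. retract (fst p) (snd p) u)" for u
    unfolding retract_def
    by (intro continuous_intros p) (use V push_facts(3) in force)+
  show "retract (fst p) (snd p) \<in> topspace X" if "p \<in> topspace ?P" for p
    using that retract_in_X by auto
qed

section \<open>The quotient map that sends each cell onto a sphere of the wedge\<close>

definition cell_index :: "'a set \<Rightarrow> nat" where
  "cell_index = (SOME b. bij_betw b F {0..<card F})"

definition vertex_index :: "'a set \<Rightarrow> nat \<Rightarrow> 'a" where
  "vertex_index \<sigma> = (SOME e. bij_betw e {..d} \<sigma>)"

lemma cell_index: "bij_betw cell_index F {0..<card F}"
  unfolding cell_index_def using ex_bij_betw_finite_nat[OF finite_F] by (rule someI_ex)

lemma vertex_index:
  assumes "\<sigma> \<in> F"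
  shows "bij_betw (vertex_index \<sigma>) {..d} \<sigma>"
proof -
  have "\<exists>e. bij_betw e {..d} \<sigma>"
    using cell[OF assms] cells[OF assms] by (intro finite_same_card_bij) simp_all
  then show ?thesis unfolding vertex_index_def by (rule someI_ex)
qed

definition cell_coords :: "'a set \<Rightarrow> ('a \<Rightarrow> real) \<Rightarrow> nat \<Rightarrow> real" where
  "cell_coords \<sigma> x i = x (vertex_index \<sigma> i)"

lemma simplex_min_cell_coords: "\<sigma> \<in> F \<Longrightarrow> simplex_min d (cell_coords \<sigma> x) = cell_min \<sigma> x"
  using bij_betw_imp_surj_on[OF vertex_index]
  by (simp add: simplex_min_def cell_min_def cell_coords_def[abs_def] flip: image_image)

lemma cell_coords_in_simplex:
  assumes x: "x \<in> topspace X" "carrier_face x \<subseteq> \<sigma>" and \<sigma>: "\<sigma> \<in> F"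
  shows "cell_coords \<sigma> x \<in> std_simplex d"
proof -
  have "sum (cell_coords \<sigma> x) {..d} = sum x \<sigma>"
    unfolding cell_coords_def using sum.reindex_bij_betw[OF vertex_index[OF \<sigma>]] .
  also have "\<dots> = sum x V"
    by (rule sum.mono_neutral_left) (use cell[OF \<sigma>] x V in auto)
  finally show ?thesis
    using x(1) by (simp add: std_simplex_def in_X cell_coords_def)
qed

definition collapse :: "('a \<Rightarrow> real) \<Rightarrow> (nat \<times> (nat \<Rightarrow> real)) option" where
  "collapse x = (let \<sigma> = carrier_face x in
     if \<sigma> \<in> F then Some (cell_index \<sigma>, simplex_to_sphere d (cell_coords \<sigma> x)) else None)"

text \<open>The definition of \<open>collapse\<close> distinguishes carriers, but
  \<open>simplex_to_sphere\<close> sends the boundary of the simplex to the basepoint anyway, and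
  \<open>wedge_collapse\<close> turns that into \<open>None\<close>. Hence one continuous formula
  serves the whole closed cell, as the pasting argument requires.\<close>

lemma collapse_on_cell:
  assumes x: "x \<in> topspace X" "carrier_face x \<subseteq> \<sigma>" and \<sigma>: "\<sigma> \<in> F"
  shows "collapse x =
    wedge_collapse (\<lambda>_. nsphere_basepoint) (cell_index \<sigma>, simplex_to_sphere d (cell_coords \<sigma> x))"
proof (cases "carrier_face x = \<sigma>")
  case True
  then have "simplex_to_sphere d (cell_coords \<sigma> x) \<noteq> nsphere_basepoint"
    using cell_min_pos[OF x(1)] \<sigma>
    by (simp add: simplex_to_sphere_eq_basepoint_iff[OF cell_coords_in_simplex[OF x \<sigma>]]
        simplex_min_cell_coords)
  then show ?thesis using True \<sigma> by (simp add: collapse_def wedge_collapse_def Let_def)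
next
  case False
  then have "carrier_face x \<in> L" using proper_face[OF \<sigma>] x(2) by blast
  moreover have "simplex_to_sphere d (cell_coords \<sigma> x) = nsphere_basepoint"
    using cell_min_eq_0[OF x(1) \<sigma> False]
    by (simp add: simplex_to_sphere_eq_basepoint_iff[OF cell_coords_in_simplex[OF x \<sigma>]]
        simplex_min_cell_coords[OF \<sigma>])
  ultimately show ?thesis by (simp add: collapse_def wedge_collapse_def Let_def)
qed

abbreviation "W \<equiv> wedge_of_spheres (card F) d"

lemma topspace_W:
  "topspace W = wedge_collapse (\<lambda>_. nsphere_basepoint) ` ({0..<card F} \<times> topspace (nsphere d))"
  by (simp add: wedge_of_spheres_def wedge_sum_def o_def)

lemma collapse_eq_None_iff: "x \<in> topspace X \<Longrightarrow> collapse x = None \<longleftrightarrow> carrier_face x \<in> L"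
  by (auto simp: collapse_def Let_def in_X)

lemma continuous_map_collapse:
  assumes "F \<noteq> {}"
  shows "continuous_map X W collapse"
proof (rule pasting_lemma_closed[where I = K
    and T = "\<lambda>\<sigma>. {x \<in> topspace X. carrier_face x \<subseteq> \<sigma>}" and f = "\<lambda>_. collapse"])
  show "finite K" using V K(1) by (meson finite_Pow_iff finite_subset)
  show "closedin X {x \<in> topspace X. carrier_face x \<subseteq> \<sigma>}" for \<sigma>
    by (rule closedin_carrier_face_subset[OF V K(1)])
  show "continuous_map (subtopology X {x \<in> topspace X. carrier_face x \<subseteq> \<sigma>}) W collapse"
    if \<sigma>: "\<sigma> \<in> K" for \<sigma>
  proof (cases "\<sigma> \<in> L")
    case True
    then have none: "collapse x = None" if "x \<in> topspace X" "carrier_face x \<subseteq> \<sigma>" for x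
      using that L(2) down_closedD collapse_eq_None_iff by metis
    \<comment> \<open>The identified basepoint exists only if there is a sphere to contribute it:
      the wedge of no spheres, as encoded, is the empty space.\<close>
    have "None \<in> topspace W"
    proof -
      have "0 < card F" using assms finite_F by (simp add: card_gt_0_iff)
      then have "(0, nsphere_basepoint) \<in> {0..<card F} \<times> topspace (nsphere d)"
        using nsphere_basepoint_in_nsphere by auto
      moreover have "None = wedge_collapse (\<lambda>_. nsphere_basepoint) (0::nat, nsphere_basepoint)"
        by (simp add: wedge_collapse_def)
      ultimately show ?thesis unfolding topspace_W by (rule image_eqI[rotated])
    qed
    then have "continuous_map (subtopology X {x \<in> topspace X. carrier_face x \<subseteq> \<sigma>}) W (\<lambda>_. None)"
      by simp
    then show ?thesis
      by (rule continuous_map_eq) (use none in auto)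
  next
    case False
    then have \<sigma>F: "\<sigma> \<in> F" using \<sigma> by simp
    let ?Y = "subtopology X {x \<in> topspace X. carrier_face x \<subseteq> \<sigma>}"
    have "continuous_map ?Y euclideanreal (\<lambda>x. cell_coords \<sigma> x i)" for i
      unfolding cell_coords_def by (intro continuous_map_from_subtopology continuous_map_coordinate)
    then have 1: "continuous_map ?Y (nsphere d) (\<lambda>x. simplex_to_sphere d (cell_coords \<sigma> x))"
      by (intro continuous_map_simplex_to_sphere) (auto intro: cell_coords_in_simplex[OF _ _ \<sigma>F])
    have 2: "cell_index \<sigma> \<in> {0..<card F}"
      using cell_index \<sigma>F bij_betwE by blast
    have 3: "continuous_map ?Y (sum_topology (\<lambda>_. nsphere d) {0..<card F})
        (\<lambda>x. (cell_index \<sigma>, simplex_to_sphere d (cell_coords \<sigma> x)))"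
      using continuous_map_compose[OF 1 continuous_map_component_injection[OF 2]] by (simp add: o_def)
    have "continuous_map ?Y W (\<lambda>x. wedge_collapse (\<lambda>_. nsphere_basepoint)
        (cell_index \<sigma>, simplex_to_sphere d (cell_coords \<sigma> x)))"
      using continuous_map_compose[OF 3 quotient_imp_continuous_map[OF quotient_map_quotient_topology]]
      by (simp only: o_def wedge_of_spheres_def wedge_sum_def)
    then show ?thesis
      by (rule continuous_map_eq) (use collapse_on_cell[OF _ _ \<sigma>F] in auto)
  qed
qed (auto simp: in_X)

lemma collapse_surj:
  assumes "F \<noteq> {}"
  shows "collapse ` topspace X = topspace W"
proof
  show "collapse ` topspace X \<subseteq> topspace W"
    using continuous_map_image_subset_topspace[OF continuous_map_collapse[OF assms]] .
  show "topspace W \<subseteq> collapse ` topspace X"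
  proof
    fix w assume "w \<in> topspace W"
    then obtain j p where w: "j < card F" "p \<in> topspace (nsphere d)"
      "w = wedge_collapse (\<lambda>_. nsphere_basepoint) (j, p)"
      unfolding topspace_W by auto
    show "w \<in> collapse ` topspace X"
    proof (cases "p = nsphere_basepoint")
      case True
      define x where "x = (\<lambda>u. if u = v then 1 else 0 :: real)"
      have "carrier_face x = {v}" "sum x V = 1" using V v_in_V by (auto simp: x_def)
      then have "x \<in> topspace X" using v_in_L L(1) by (auto simp: in_X) (simp add: x_def)
      moreover have "collapse x = None"
        using \<open>carrier_face x = {v}\<close> v_in_L collapse_eq_None_iff[OF \<open>x \<in> topspace X\<close>] by simp
      ultimately show ?thesis using w(3) True by (force simp: wedge_collapse_def)
    next
      case False
      obtain \<sigma> where \<sigma>: "\<sigma> \<in> F" "cell_index \<sigma> = j"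
        using cell_index w(1) by (metis atLeastLessThan_iff bij_betw_imp_surj_on imageE zero_le)
      obtain y where y: "y \<in> std_simplex d" "0 < simplex_min d y" "simplex_to_sphere d y = p"
        using simplex_to_sphere_surj[OF w(2) False] by blast
      note e = vertex_index[OF \<sigma>(1)]
      \<comment> \<open>The point \<open>y\<close> is carried over to \<sigma> along the enumeration
        of its vertices; its minimum is positive, so the carrier is the entire cell and
        \<open>collapse\<close> does not return \<open>None\<close>.\<close>
      define x where "x u = (if u \<in> \<sigma> then y (inv_into {..d} (vertex_index \<sigma>) u) else 0)" for u
      have xy: "x (vertex_index \<sigma> i) = y i" if "i \<le> d" for i
        using that e by (auto simp: x_def bij_betw_def)
      have ypos: "0 < y i" if "i \<le> d" for i using simplex_min_le[OF that, of y] y(2) by simp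
      have pos: "0 < x u" if "u \<in> \<sigma>" for u
      proof -
        obtain i where "i \<le> d" "u = vertex_index \<sigma> i"
          using e \<open>u \<in> \<sigma>\<close> by (metis atMost_iff bij_betw_imp_surj_on imageE)
        then show ?thesis using xy ypos by simp
      qed
      then have car: "carrier_face x = \<sigma>" by (force simp: x_def)
      have "sum x V = sum x \<sigma>"
        by (rule sum.mono_neutral_right) (use cell[OF \<sigma>(1)] V in \<open>auto simp: x_def\<close>)
      also have "\<dots> = (\<Sum>i\<le>d. x (vertex_index \<sigma> i))"
        using sum.reindex_bij_betw[OF e, of x] by simp
      also have "\<dots> = sum y {..d}" by (rule sum.cong) (auto simp: xy)
      finally have "sum x V = 1" using y(1) by (simp add: std_simplex_def)
      moreover have "0 \<le> x u" for u using pos[of u] by (cases "u \<in> \<sigma>") (auto simp: x_def)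
      ultimately have xX: "x \<in> topspace X" using car \<sigma>(1) by (simp add: in_X)
      have "simplex_to_sphere d (cell_coords \<sigma> x) = p"
      proof -
        have c: "cell_coords \<sigma> x i = y i" if "i \<le> d" for i using xy[OF that] by (simp add: cell_coords_def)
        have "cell_coords \<sigma> x ` {..d} = y ` {..d}" using c by (intro image_cong) auto
        then have "simplex_min d (cell_coords \<sigma> x) = simplex_min d y" by (simp add: simplex_min_def)
        moreover have "simplex_skew d (cell_coords \<sigma> x) = simplex_skew d y"
          unfolding simplex_skew_def by (rule sum.cong) (auto simp: c)
        ultimately have "simplex_to_sphere d (cell_coords \<sigma> x) = simplex_to_sphere d y"
          by (auto simp: fun_eq_iff simplex_to_sphere_def c)
        then show ?thesis using y(3) by simp
      qed
      then have "collapse x = w"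
        using collapse_on_cell[OF xX _ \<sigma>(1)] car \<sigma>(2) w(3) by simp
      then show ?thesis using xX by blast
    qed
  qed
qed

lemma collapse_inj:
  assumes x: "x \<in> topspace X" "y \<in> topspace X" and eq: "collapse x = collapse y"
    and xF: "carrier_face x \<in> F"
  shows "x = y"
proof -
  define \<sigma> where "\<sigma> = carrier_face x"
  have \<sigma>: "\<sigma> \<in> F" using xF by (simp add: \<sigma>_def)
  have yF: "carrier_face y \<in> F" and
    e: "cell_index (carrier_face y) = cell_index \<sigma>"
       "simplex_to_sphere d (cell_coords \<sigma> x) = simplex_to_sphere d (cell_coords (carrier_face y) y)"
    using eq xF by (auto simp: collapse_def Let_def \<sigma>_def split: if_splits)
  have cy: "carrier_face y = \<sigma>"
    using cell_index e(1) yF \<sigma> by (meson bij_betw_imp_inj_on inj_onD)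
  have "cell_coords \<sigma> x i = cell_coords \<sigma> y i" if "i \<le> d" for i
    by (rule simplex_to_sphere_inj[where d = d])
       (use that x e(2) cy \<sigma> cell_min_pos[OF x(1)] cell_min_pos[OF x(2)] in
        \<open>simp_all add: cell_coords_in_simplex simplex_min_cell_coords \<sigma>_def\<close>)
  then have "x u = y u" if "u \<in> \<sigma>" for u
    using that vertex_index[OF \<sigma>] unfolding cell_coords_def
    by (metis atMost_iff bij_betw_imp_surj_on imageE)
  moreover have "x u = y u" if "u \<notin> \<sigma>" for u
    using that cy by (auto simp: \<sigma>_def)
  ultimately show ?thesis by blast
qed

lemma homotopy_equivalent_wedge_of_spheres:
  assumes "F \<noteq> {}"
  shows "X homotopy_equivalent_space wedge_of_spheres (card F) d"
proof (rule homotopy_equivalent_quotient_contractible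
    [where A = "{x \<in> topspace X. carrier_face x \<in> L}" and q = collapse and h = retract])
  show "compact_space X" by (rule compact_space_geometric_realization[OF V K])
  show "Hausdorff_space W" by (rule Hausdorff_space_wedge_of_spheres)
  show "continuous_map X W collapse" by (rule continuous_map_collapse[OF assms])
  show "collapse ` topspace X = topspace W" by (rule collapse_surj[OF assms])
  show "x \<in> {x \<in> topspace X. carrier_face x \<in> L} \<and> y \<in> {x \<in> topspace X. carrier_face x \<in> L}"
    if "x \<in> topspace X" "y \<in> topspace X" "collapse x = collapse y" "x \<noteq> y" for x y
    using that collapse_inj[of x y] collapse_inj[of y x] by (auto simp: in_X)
  show "collapse x = collapse y"
    if "x \<in> {x \<in> topspace X. carrier_face x \<in> L}" "y \<in> {x \<in> topspace X. carrier_face x \<in> L}" for x y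
    using that collapse_eq_None_iff by (metis (no_types, lifting) mem_Collect_eq)
  show "continuous_map (prod_topology (top_of_set {0..1}) X) X (\<lambda>p. retract (fst p) (snd p))"
    by (rule continuous_map_retract)
  show "retract 0 x = x" if "x \<in> topspace X" for x
    using that by (rule retract_0)
  show "retract t x \<in> {x \<in> topspace X. carrier_face x \<in> L}"
    if "t \<in> {0..1}" "x \<in> {x \<in> topspace X. carrier_face x \<in> L}" for t x
  proof -
    have x: "x \<in> topspace X" "carrier_face x \<in> L" and t: "0 \<le> t" "t \<le> 1" using that by auto
    have "carrier_face (retract t x) \<subseteq> insert v (carrier_face x)"
      unfolding retract_L[OF x t] by auto
    then have "carrier_face (retract t x) \<in> L"
      using cone[OF x(2)] L(2) down_closedD by metis
    then show ?thesis using retract_in_X[OF x(1) t] by simp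
  qed
  show "retract 1 x = retract 1 y"
    if "x \<in> {x \<in> topspace X. carrier_face x \<in> L}" "y \<in> {x \<in> topspace X. carrier_face x \<in> L}" for x y
    using that by (simp add: retract_L)
qed

end

section \<open>The complex of the product graph\<close>

definition alexander_dual :: "'a set \<Rightarrow> 'a set set \<Rightarrow> 'a set set" where
  "alexander_dual V S = {\<sigma>. \<sigma> \<subseteq> V \<and> V - \<sigma> \<notin> S}"

lemma down_closed_alexander_dual:
  assumes "down_closed S" shows "down_closed (alexander_dual V S)"
  unfolding down_closed_def alexander_dual_def
proof clarify
  fix \<sigma> \<tau> assume \<sigma>: "\<sigma> \<subseteq> V" "V - \<sigma> \<notin> S" and \<tau>: "\<tau> \<subseteq> \<sigma>"
  then have "V - \<tau> \<notin> S" using down_closedD[OF assms, of "V - \<tau>" "V - \<sigma>"] by blast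
  then show "\<tau> \<subseteq> V \<and> V - \<tau> \<notin> S" using \<sigma> \<tau> by blast
qed

text \<open>Complementation carries the pairing of added faces by \<open>w\<close> to a pairing of
  removed dual faces, with insertion and deletion of \<open>w\<close> exchanged, so the collapse
  lemma applies. The condition \<open>V \<notin> S'\<close> puts the empty face into the smaller
  dual.\<close>

lemma homotopy_equivalent_dual_expansion:
  assumes V: "finite V" "w \<in> V" and S: "S \<subseteq> S'" "down_closed S" "down_closed S'" "V \<notin> S'"
    and toggle: "\<And>B. B \<in> S' - S \<Longrightarrow> insert w B \<in> S' - S \<and> B - {w} \<in> S' - S"
  shows "geometric_realization (alexander_dual V S) homotopy_equivalent_space
         geometric_realization (alexander_dual V S')"
proof (rule homotopy_equivalent_collapse[OF V])
  show "alexander_dual V S \<subseteq> Pow V" "alexander_dual V S' \<subseteq> alexander_dual V S"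
    using S(1) by (auto simp: alexander_dual_def)
  show "alexander_dual V S' \<noteq> {}"
    using S(4) by (auto simp: alexander_dual_def)
  fix \<sigma> assume \<sigma>: "\<sigma> \<in> alexander_dual V S - alexander_dual V S'"
  then have "V - \<sigma> \<in> S' - S" by (auto simp: alexander_dual_def)
  note t = toggle[OF this]
  have "V - insert w \<sigma> = V - \<sigma> - {w}" "V - (\<sigma> - {w}) = insert w (V - \<sigma>)"
    using V(2) by auto
  then show "insert w \<sigma> \<in> alexander_dual V S - alexander_dual V S' \<and>
        \<sigma> - {w} \<in> alexander_dual V S - alexander_dual V S'"
    using t \<sigma> V(2) by (auto simp: alexander_dual_def)
qed (auto intro: down_closed_alexander_dual S)

text \<open>The spine edges form the path through the columns; \<open>stage k\<close> adds to the clique complex the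
  cone with apex \<open>apex\<close> over the first \<open>k + 1\<close> columns and the path joining them. The second
  vertex of the path is chosen as apex because no chord contains it.\<close>

locale prism =
  fixes m n :: nat
  assumes m: "2 \<le> m" and n: "4 \<le> n"
begin

definition V :: "(nat \<times> nat) set" where "V = {0..<m} \<times> {0..<n}"
definition column :: "nat \<Rightarrow> (nat \<times> nat) set" where "column j = {0..<m} \<times> {j}"
definition spine :: "nat \<Rightarrow> (nat \<times> nat) set" where "spine j = {(0, j), (0, Suc j)}"
definition chords :: "(nat \<times> nat) set set" where
  "chords = (\<lambda>(i, j). {(i, j), (i, Suc j)}) ` ({1..<m} \<times> {0..<n - 1})
            \<union> (\<lambda>i. {(i, 0), (i, n - 1)}) ` {0..<m}"
text \<open>An explicit list of faces, split according to their role in the construction. That these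
  are precisely the cliques of the product graph follows from \<open>down_closed_cliques\<close>,
  \<open>clique_pair_edge\<close> and \<open>clique_in_cliques\<close>.\<close>

definition cliques :: "(nat \<times> nat) set set" where
  "cliques = {\<sigma>. \<exists>j<n. \<sigma> \<subseteq> column j} \<union> {spine j | j. Suc j < n} \<union> chords"
definition apex :: "nat \<times> nat" where "apex = (0, 1)"
definition stage :: "nat \<Rightarrow> (nat \<times> nat) set set" where
  "stage k = cliques \<union> {insert apex \<sigma> | \<sigma>. \<exists>j\<le>k. \<sigma> \<subseteq> column j} \<union> {insert apex (spine j) | j. j < k}"
text \<open>One stage step needs two different pairing vertices. Here the path is extended first:
  the triangle over \<open>spine k\<close> enters with its free edge, paired by
  \<open>(0, k)\<close>. The next column can then be coned off with \<open>(0, Suc k)\<close> as the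
  pairing vertex.\<close>

definition half_stage :: "nat \<Rightarrow> (nat \<times> nat) set set" where
  "half_stage k = stage k \<union> {{apex, (0, Suc k)}, {apex, (0, k), (0, Suc k)}}"
definition full_cone :: "(nat \<times> nat) set set" where
  "full_cone = cliques \<union> insert apex ` cliques"

lemma finite_V: "finite V" by (simp add: V_def)
lemma card_V: "card V = m * n" by (simp add: V_def)
lemma apex_in_V: "apex \<in> V" using m n by (simp add: V_def apex_def)

lemma chordE:
  assumes "e \<in> chords"
  obtains i j where "1 \<le> i" "i < m" "Suc j < n" "e = {(i, j), (i, Suc j)}"
    | i where "i < m" "e = {(i, 0), (i, n - 1)}"
proof -
  from assms consider p where "p \<in> {1..<m} \<times> {0..<n - 1}" "e = (\<lambda>(i, j). {(i, j), (i, Suc j)}) p"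
    | i where "i \<in> {0..<m}" "e = {(i, 0), (i, n - 1)}"
    unfolding chords_def by blast
  then show thesis
  proof cases
    case 1
    then show thesis by (intro that(1)[of "fst p" "snd p"]) auto
  qed (auto intro: that(2))
qed

lemma cliqueE:
  assumes "\<sigma> \<in> cliques"
  obtains j where "j < n" "\<sigma> \<subseteq> column j"
    | j where "Suc j < n" "\<sigma> = spine j"
    | i j where "1 \<le> i" "i < m" "Suc j < n" "\<sigma> = {(i, j), (i, Suc j)}"
    | i where "i < m" "\<sigma> = {(i, 0), (i, n - 1)}"
  using assms chordE unfolding cliques_def by blast

lemma columnD: "\<sigma> \<subseteq> column j \<Longrightarrow> (i, k) \<in> \<sigma> \<Longrightarrow> k = j"
  by (auto simp: column_def)

lemma not_subset_column: "\<lbrakk>a \<in> \<sigma>; b \<in> \<sigma>; snd a \<noteq> snd b\<rbrakk> \<Longrightarrow> \<not> \<sigma> \<subseteq> column j"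
  using columnD by (metis prod.collapse)

lemma column_clique: "j < n \<Longrightarrow> \<sigma> \<subseteq> column j \<Longrightarrow> \<sigma> \<in> cliques"
  by (auto simp: cliques_def)

lemma spine_clique: "Suc j < n \<Longrightarrow> spine j \<in> cliques"
  by (auto simp: cliques_def)

lemma singleton_clique: "a \<in> V \<Longrightarrow> \<tau> \<subseteq> {a} \<Longrightarrow> \<tau> \<in> cliques"
  by (rule column_clique[of "snd a"]) (auto simp: V_def column_def)

lemma subset_doubleton: "\<tau> \<subseteq> {a, b} \<Longrightarrow> \<tau> = {a, b} \<or> \<tau> \<subseteq> {a} \<or> \<tau> \<subseteq> {b}"
  by blast

lemma cliques_in_V: "\<sigma> \<in> cliques \<Longrightarrow> \<sigma> \<subseteq> V"
  using m n by (erule_tac cliqueE) (auto simp: V_def column_def spine_def)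

lemma down_closed_cliques: "down_closed cliques"
proof -
  have "\<tau> \<in> cliques" if \<sigma>: "\<sigma> \<in> cliques" and \<tau>: "\<tau> \<subseteq> \<sigma>" for \<sigma> \<tau>
  proof (cases "\<exists>j<n. \<sigma> \<subseteq> column j")
    case True
    then show ?thesis using \<tau> column_clique by blast
  next
    case False
    then obtain a b where ab: "\<sigma> = {a, b}"
      using \<sigma> by (elim cliqueE) (auto simp: spine_def)
    then have "a \<in> V" "b \<in> V" using cliques_in_V[OF \<sigma>] by auto
    then show ?thesis
      using subset_doubleton[of \<tau> a b] \<sigma> \<tau> ab singleton_clique by metis
  qed
  then show ?thesis by (auto simp: down_closed_def)
qed

lemma cliques_subset_stage: "cliques \<subseteq> stage k"
  by (auto simp: stage_def)

lemma stage_column: "j \<le> k \<Longrightarrow> \<sigma> \<subseteq> column j \<Longrightarrow> insert apex \<sigma> \<in> stage k"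
  unfolding stage_def by blast

lemma stage_spine: "j < k \<Longrightarrow> insert apex (spine j) \<in> stage k"
  unfolding stage_def by blast

lemma stageE:
  assumes "\<sigma> \<in> stage k"
  obtains "\<sigma> \<in> cliques" | j \<sigma>' where "j \<le> k" "\<sigma>' \<subseteq> column j" "\<sigma> = insert apex \<sigma>'"
    | j where "j < k" "\<sigma> = insert apex (spine j)"
  using assms unfolding stage_def by blast

lemma down_closed_stage:
  assumes "k < n" shows "down_closed (stage k)"
proof -
  have "\<tau> \<in> stage k" if \<sigma>: "\<sigma> \<in> stage k" and \<tau>: "\<tau> \<subseteq> \<sigma>" for \<sigma> \<tau>
  proof (cases "apex \<in> \<tau>")
    case False
    have "\<tau> \<in> cliques"
    proof -
      from \<sigma> obtain \<rho> where "\<rho> \<in> cliques" "\<sigma> \<subseteq> insert apex \<rho>"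
      proof (cases rule: stageE)
        case (2 j \<sigma>')
        then show ?thesis using that[of \<sigma>'] column_clique[of j \<sigma>'] assms by auto
      next
        case (3 j)
        then show ?thesis using that[of "spine j"] spine_clique[of j] assms by auto
      qed blast
      then show ?thesis using \<tau> False down_closedD[OF down_closed_cliques, of \<rho> \<tau>] by blast
    qed
    then show ?thesis by (simp add: stage_def)
  next
    case True
    then have \<tau>': "\<tau> = insert apex (\<tau> - {apex})" by blast
    from \<sigma> show ?thesis
    proof (cases rule: stageE)
      case 1
      then show ?thesis using \<tau> down_closedD[OF down_closed_cliques] by (auto simp: stage_def)
    next
      case (2 j \<sigma>')
      then have "\<tau> - {apex} \<subseteq> column j" using \<tau> by blast
      then show ?thesis using 2(1) \<tau>' stage_column by metis
    next
      case (3 j)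
      then have "\<tau> - {apex} \<subseteq> spine j" using \<tau> by blast
      then consider "\<tau> - {apex} = spine j" | "\<tau> - {apex} \<subseteq> {(0, j)}" | "\<tau> - {apex} \<subseteq> {(0, Suc j)}"
        unfolding spine_def using subset_doubleton by metis
      then show ?thesis
      proof cases
        case 1 then show ?thesis using 3(1) \<tau>' stage_spine by metis
      next
        case 2
        then have "\<tau> - {apex} \<subseteq> column j" using m by (auto simp: column_def)
        moreover have "j \<le> k" using 3(1) by simp
        ultimately show ?thesis using \<tau>' stage_column by metis
      next
        case c: 3
        then have "\<tau> - {apex} \<subseteq> column (Suc j)" using m by (auto simp: column_def)
        moreover have "Suc j \<le> k" using 3(1) by simp
        ultimately show ?thesis using \<tau>' stage_column by metis
      qed
    qed
  qed
  then show ?thesis by (auto simp: down_closed_def)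
qed

lemma down_closed_full_cone: "down_closed full_cone"
proof -
  have "\<tau> \<in> full_cone" if \<sigma>: "\<sigma> \<in> full_cone" and \<tau>: "\<tau> \<subseteq> \<sigma>" for \<sigma> \<tau>
  proof -
    obtain \<rho> where "\<rho> \<in> cliques" "\<sigma> \<subseteq> insert apex \<rho>" using \<sigma> by (auto simp: full_cone_def)
    then have "\<tau> - {apex} \<in> cliques" using \<tau> down_closedD[OF down_closed_cliques, of \<rho>] by blast
    moreover have "\<tau> = \<tau> - {apex} \<or> \<tau> = insert apex (\<tau> - {apex})" by blast
    ultimately show ?thesis unfolding full_cone_def by (metis UnI1 UnI2 imageI)
  qed
  then show ?thesis by (auto simp: down_closed_def)
qed

lemma stage_subset:
  assumes "k < n" shows "stage k \<subseteq> full_cone"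
proof
  fix \<sigma> assume "\<sigma> \<in> stage k"
  then show "\<sigma> \<in> full_cone"
  proof (cases rule: stageE)
    case (2 j \<sigma>')
    then have "\<sigma>' \<in> cliques" using column_clique[of j] assms by simp
    then show ?thesis using 2 by (simp add: full_cone_def)
  next
    case (3 j)
    then have "spine j \<in> cliques" using spine_clique[of j] assms by simp
    then show ?thesis using 3 by (simp add: full_cone_def)
  qed (simp add: full_cone_def)
qed

lemma half_stage_subset: "Suc k < n \<Longrightarrow> half_stage k \<subseteq> stage (Suc k)"
proof -
  assume k: "Suc k < n"
  have "{apex, (0, k), (0, Suc k)} = insert apex (spine k)" by (simp add: spine_def)
  moreover have "{(0, Suc k)} \<subseteq> column (Suc k)" using m by (auto simp: column_def)
  moreover have "stage k \<subseteq> stage (Suc k)"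
    by (auto elim!: stageE intro: stage_column stage_spine le_SucI less_SucI
        simp: cliques_subset_stage[THEN subsetD])
  ultimately show ?thesis
    unfolding half_stage_def
    using stage_column[of "Suc k" "Suc k" "{(0, Suc k)}"] stage_spine[of k "Suc k"] by auto
qed

text \<open>The witnesses \<open>(1, 0)\<close> and \<open>(1, 2)\<close> differ from the apex and
  lie in distinct columns, and n \<ge> 4 keeps columns 0 and 2 from being neighbours on the
  cycle.\<close>

lemma V_notin_full_cone: "V \<notin> full_cone"
proof
  assume "V \<in> full_cone"
  then obtain \<rho> where \<rho>: "\<rho> \<in> cliques" "V \<subseteq> insert apex \<rho>" by (auto simp: full_cone_def)
  have "(1, 0) \<in> V" "(1, 2) \<in> V" using m n by (auto simp: V_def)
  then have "(1, 0) \<in> \<rho>" "(1, 2) \<in> \<rho>" using \<rho>(2) by (auto simp: apex_def)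
  moreover from this have "\<not> \<rho> \<subseteq> column j" for j by (rule not_subset_column) simp
  ultimately show False using \<rho>(1) n
    by (elim cliqueE) (auto simp: spine_def)
qed

section \<open>Expansion of the clique complex, one column at a time\<close>

text \<open>Since the edge from the apex to \<open>(0, j)\<close> is present already, every new face
  contains some \<open>(i, j)\<close> with i \<ge> 1 besides the apex. Such a face stays new when
  \<open>(0, j)\<close> is inserted or deleted. The condition on \<open>j\<close> separates
  \<open>(0, j)\<close> from the apex.\<close>

lemma column_expansion:
  assumes C: "cliques \<subseteq> C" "down_closed C" and j: "j < n" "j \<noteq> 1"
    and edge: "{apex, (0, j)} \<in> C"
    and new: "\<And>i \<sigma>. \<lbrakk>1 \<le> i; (i, j) \<in> \<sigma>; apex \<in> \<sigma>\<rbrakk> \<Longrightarrow> \<sigma> \<notin> C"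
    and C': "C' = C \<union> {insert apex \<sigma> | \<sigma>. \<sigma> \<subseteq> column j}" "C' \<subseteq> full_cone"
  shows "geometric_realization (alexander_dual V C) homotopy_equivalent_space
         geometric_realization (alexander_dual V C')"
proof (rule homotopy_equivalent_dual_expansion[OF finite_V, of "(0, j)"])
  show "(0, j) \<in> V" using j m by (auto simp: V_def)
  show "C \<subseteq> C'" using C'(1) by blast
  show "down_closed C" by fact
  show "V \<notin> C'" using V_notin_full_cone C'(2) by blast
  have "\<tau> \<in> C'" if "\<sigma> \<in> C'" "\<tau> \<subseteq> \<sigma>" for \<sigma> \<tau>
  proof (cases "\<sigma> \<in> C")
    case True
    then show ?thesis using down_closedD[OF C(2)] that(2) C'(1) by blast
  next
    case False
    then have "\<sigma> - {apex} \<subseteq> column j" using that(1) C'(1) by blast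
    then have s: "\<tau> - {apex} \<subseteq> column j" using that(2) by blast
    then have "\<tau> - {apex} \<in> C'" using column_clique[OF j(1)] C(1) C'(1) by blast
    moreover have "insert apex (\<tau> - {apex}) \<in> C'" using s C'(1) by blast
    moreover have "\<tau> = \<tau> - {apex} \<or> \<tau> = insert apex (\<tau> - {apex})" by blast
    ultimately show ?thesis by metis
  qed
  then show "down_closed C'" by (auto simp: down_closed_def)
  fix B assume B: "B \<in> C' - C"
  then obtain \<sigma> where \<sigma>: "\<sigma> \<subseteq> column j" "B = insert apex \<sigma>" using C'(1) by blast
  have "\<not> B \<subseteq> {apex, (0, j)}" using B edge down_closedD[OF C(2)] by blast
  then obtain u where u: "u \<in> \<sigma>" "u \<noteq> (0, j)" using \<sigma> by blast
  then obtain i where i: "1 \<le> i" "u = (i, j)" using \<sigma>(1) by (cases u) (auto simp: column_def)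
  have "insert (0, j) B = insert apex (insert (0, j) \<sigma>)" "insert (0, j) \<sigma> \<subseteq> column j"
    using \<sigma> m by (auto simp: column_def)
  then have "insert (0, j) B \<in> C'" using C'(1) by blast
  moreover have "insert (0, j) B \<notin> C" using B down_closedD[OF C(2)] by blast
  moreover have "B - {(0, j)} = insert apex (\<sigma> - {(0, j)})"
    using \<sigma>(2) j(2) by (auto simp: apex_def)
  moreover have "insert apex (\<sigma> - {(0, j)}) \<in> C'" using \<sigma>(1) C'(1) by blast
  moreover have "insert apex (\<sigma> - {(0, j)}) \<notin> C" using new[of i] i u by simp
  ultimately show "insert (0, j) B \<in> C' - C \<and> B - {(0, j)} \<in> C' - C" by simp
qed

text \<open>The apex belongs to column 1 and to \<open>spine 0\<close>, so coning these adds
  nothing. Column 0 is the only new part, and \<open>spine 0\<close> is the edge from which its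
  expansion starts.\<close>

lemma cliques_stage_1:
  "geometric_realization (alexander_dual V cliques) homotopy_equivalent_space
   geometric_realization (alexander_dual V (stage 1))"
proof (rule column_expansion[where j = 0])
  have "{apex, (0, 0)} = spine 0" by (auto simp: apex_def spine_def)
  then show "{apex, (0, 0)} \<in> cliques" using spine_clique[of 0] n by simp
  show "\<sigma> \<notin> cliques" if "1 \<le> i" "(i, 0) \<in> \<sigma>" "apex \<in> \<sigma>" for i \<sigma>
    using that by (auto elim!: cliqueE dest: columnD simp: apex_def spine_def)
  have "insert apex (spine 0) = spine 0" by (auto simp: apex_def spine_def)
  then have 1: "insert apex (spine 0) \<in> cliques" using spine_clique[of 0] n by simp
  have 2: "insert apex \<sigma> \<in> cliques" if "\<sigma> \<subseteq> column 1" for \<sigma>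
    by (rule column_clique[of 1]) (use that n m in \<open>auto simp: apex_def column_def\<close>)
  show "stage 1 = cliques \<union> {insert apex \<sigma> | \<sigma>. \<sigma> \<subseteq> column 0}"
    using 1 2 unfolding stage_def by (auto simp: le_Suc_eq)
  show "stage 1 \<subseteq> full_cone" using stage_subset[of 1] n by simp
qed (use n down_closed_cliques in auto)

lemma far_edge_notin_stage:
  assumes "2 \<le> k" "Suc k < n"
  shows "{apex, (0, Suc k)} \<notin> stage k"
proof
  assume "{apex, (0, Suc k)} \<in> stage k"
  then show False
  proof (cases rule: stageE)
    case 1
    then show False using assms
      by (elim cliqueE) (auto simp: apex_def column_def spine_def doubleton_eq_iff)
  next
    case (2 j \<sigma>)
    then have "(0, Suc k) \<in> insert apex \<sigma>" by blast
    then show False using 2(1,2) assms by (auto simp: apex_def column_def)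
  next
    case (3 j)
    then have "(0, Suc k) \<in> insert apex (spine j)" by blast
    then show False using 3(1) assms by (auto simp: apex_def spine_def)
  qed
qed

lemma down_closed_half_stage:
  assumes k: "1 \<le> k" "Suc k < n"
  shows "down_closed (half_stage k)"
proof -
  have "\<tau> \<in> half_stage k" if \<tau>: "\<tau> \<subseteq> {apex, (0, k), (0, Suc k)}" for \<tau>
  proof (cases "(0, Suc k) \<in> \<tau> \<and> apex \<in> \<tau>")
    case True
    then have "\<tau> = {apex, (0, Suc k)} \<or> \<tau> = {apex, (0, k), (0, Suc k)}" using \<tau> by blast
    then show ?thesis by (auto simp: half_stage_def)
  next
    case False
    then consider "\<tau> \<subseteq> spine k" | "\<tau> \<subseteq> insert apex {(0, k)}" using \<tau> unfolding spine_def by blast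
    then have "\<tau> \<in> stage k"
    proof cases
      case 1
      then show ?thesis
        using down_closedD[OF down_closed_cliques spine_clique[OF k(2)]] by (auto simp: stage_def)
    next
      case 2
      have "{(0, k)} \<subseteq> column k" using m by (auto simp: column_def)
      then have "insert apex {(0, k)} \<in> stage k" unfolding stage_def by blast
      then show ?thesis using 2 down_closedD[OF down_closed_stage] k by (metis Suc_lessD)
    qed
    then show ?thesis by (simp add: half_stage_def)
  qed
  note small = this
  have "\<tau> \<in> half_stage k" if \<sigma>: "\<sigma> \<in> half_stage k" and \<tau>: "\<tau> \<subseteq> \<sigma>" for \<sigma> \<tau>
  proof (cases "\<sigma> \<in> stage k")
    case True
    then have "\<tau> \<in> stage k" using down_closedD[OF down_closed_stage, of k \<sigma> \<tau>] k \<tau> by simp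
    then show ?thesis by (simp add: half_stage_def)
  next
    case False
    then have "\<sigma> \<subseteq> {apex, (0, k), (0, Suc k)}" using \<sigma> by (auto simp: half_stage_def)
    then show ?thesis using small \<tau> by simp
  qed
  then show ?thesis by (auto simp: down_closed_def)
qed

text \<open>For k = 1 the apex is \<open>(0, k)\<close> itself and the extra edge is
  \<open>spine 1\<close>, so nothing is added. For larger k the extra edge and the triangle are both
  new and differ exactly in \<open>(0, k)\<close>, while the other two edges of the triangle are
  present already.\<close>

lemma stage_half_stage:
  assumes k: "1 \<le> k" "Suc k < n"
  shows "geometric_realization (alexander_dual V (stage k)) homotopy_equivalent_space
         geometric_realization (alexander_dual V (half_stage k))"
proof (cases "k = 1")
  case True
  have "{apex, (0, 2)} = spine 1" by (auto simp: apex_def spine_def)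
  then have "{apex, (0, 2)} \<in> cliques" using spine_clique[of 1] n by simp
  then have "half_stage k = stage k"
    using True by (auto simp: half_stage_def stage_def apex_def numeral_2_eq_2)
  then show ?thesis by (simp add: homotopy_equivalent_space_refl)
next
  case False
  then have k2: "2 \<le> k" using k by simp
  note far = far_edge_notin_stage[OF k2 k(2)]
  have far': "{apex, (0, k), (0, Suc k)} \<notin> stage k"
    using far down_closedD[OF down_closed_stage, of k _ "{apex, (0, Suc k)}"] k by auto
  have new: "half_stage k - stage k = {{apex, (0, Suc k)}, {apex, (0, k), (0, Suc k)}}"
    using far far' by (auto simp: half_stage_def)
  show ?thesis
  proof (rule homotopy_equivalent_dual_expansion[OF finite_V, of "(0, k)"])
    show "(0, k) \<in> V" using k m by (auto simp: V_def)
    show "stage k \<subseteq> half_stage k" by (auto simp: half_stage_def)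
    show "down_closed (stage k)" "down_closed (half_stage k)"
      using down_closed_stage down_closed_half_stage k by auto
    show "V \<notin> half_stage k"
      using V_notin_full_cone half_stage_subset[OF k(2)] stage_subset[OF k(2)] by blast
    fix B assume "B \<in> half_stage k - stage k"
    then show "insert (0, k) B \<in> half_stage k - stage k \<and> B - {(0, k)} \<in> half_stage k - stage k"
      unfolding new using k2 by (auto simp: apex_def)
  qed
qed

lemma half_stage_stage:
  assumes k: "1 \<le> k" "Suc k < n"
  shows "geometric_realization (alexander_dual V (half_stage k)) homotopy_equivalent_space
         geometric_realization (alexander_dual V (stage (Suc k)))"
proof (rule column_expansion[where j = "Suc k"])
  show "cliques \<subseteq> half_stage k" by (auto simp: half_stage_def stage_def)
  show "down_closed (half_stage k)" using down_closed_half_stage[OF k] .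
  show "{apex, (0, Suc k)} \<in> half_stage k" by (simp add: half_stage_def)
  show "\<sigma> \<notin> half_stage k" if i: "1 \<le> i" "(i, Suc k) \<in> \<sigma>" "apex \<in> \<sigma>" for i \<sigma>
  proof
    assume "\<sigma> \<in> half_stage k"
    then consider "\<sigma> \<in> cliques"
      | j \<sigma>' where "j \<le> k" "\<sigma>' \<subseteq> column j" "\<sigma> = insert apex \<sigma>'"
      | j where "\<sigma> = insert apex (spine j)"
      | "\<sigma> \<subseteq> {apex, (0, k), (0, Suc k)}"
      unfolding half_stage_def stage_def by blast
    then show False
    proof cases
      case 1
      then show False using i k by (elim cliqueE) (auto simp: apex_def column_def spine_def)
    qed (use i k in \<open>auto simp: apex_def column_def spine_def\<close>)
  qed
  have "{apex, (0, Suc k)} = insert apex {(0, Suc k)}" by simp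
  moreover have "{(0, Suc k)} \<subseteq> column (Suc k)" using m by (auto simp: column_def)
  moreover have "{apex, (0, k), (0, Suc k)} = insert apex (spine k)" by (auto simp: spine_def)
  ultimately show "stage (Suc k) = half_stage k \<union> {insert apex \<sigma> | \<sigma>. \<sigma> \<subseteq> column (Suc k)}"
    unfolding half_stage_def stage_def by (auto simp: le_Suc_eq less_Suc_eq)
  show "stage (Suc k) \<subseteq> full_cone" using stage_subset k by simp
qed (use k in auto)

lemma cliques_stage:
  assumes "1 \<le> k" "k < n"
  shows "geometric_realization (alexander_dual V cliques) homotopy_equivalent_space
         geometric_realization (alexander_dual V (stage k))"
  using assms
proof (induction k rule: dec_induct)
  case base
  show ?case by (rule cliques_stage_1)
next
  case (step k)
  then show ?case
    using homotopy_eqv_trans[OF homotopy_eqv_trans[OF _ stage_half_stage[of k]] half_stage_stage[of k]]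
    by simp
qed

section \<open>The cells that distinguish the last stage from the full cone\<close>

text \<open>At the last stage every clique other than a chord has been coned. A coned chord cannot
  have appeared before: it has three vertices, two of which differ from the apex and lie in
  different columns, so it is neither a clique nor part of a coned column. It is not a coned path
  edge either, because a chord in row 0 joins columns 0 and n - 1.\<close>

lemma full_cone_minus_stage: "full_cone - stage (n - 1) = insert apex ` chords"
proof
  show "full_cone - stage (n - 1) \<subseteq> insert apex ` chords"
  proof
    fix B assume B: "B \<in> full_cone - stage (n - 1)"
    then have "B \<notin> cliques" by (simp add: stage_def)
    then obtain \<sigma> where \<sigma>: "\<sigma> \<in> cliques" "B = insert apex \<sigma>"
      using B by (auto simp: full_cone_def)
    have "\<not> \<sigma> \<subseteq> column j" if "j < n" for j
    proof
      assume "\<sigma> \<subseteq> column j"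
      moreover have "j \<le> n - 1" using that by simp
      ultimately show False using B \<sigma>(2) unfolding stage_def by blast
    qed
    moreover have "\<sigma> \<noteq> spine j" if "Suc j < n" for j
    proof
      assume "\<sigma> = spine j"
      moreover have "j < n - 1" using that by simp
      ultimately show False using B \<sigma>(2) unfolding stage_def by blast
    qed
    ultimately have "\<sigma> \<in> chords" using \<sigma>(1) unfolding cliques_def by blast
    then show "B \<in> insert apex ` chords" using \<sigma>(2) by blast
  qed
  show "insert apex ` chords \<subseteq> full_cone - stage (n - 1)"
  proof
    fix B assume "B \<in> insert apex ` chords"
    then obtain e where e: "e \<in> chords" "B = insert apex e" by blast
    have "e \<in> cliques" using e(1) by (simp add: cliques_def)
    moreover have "B \<notin> stage (n - 1)"
    proof
      assume "B \<in> stage (n - 1)"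
      then consider "B \<in> cliques"
        | j \<sigma> where "\<sigma> \<subseteq> column j" "B = insert apex \<sigma>"
        | j where "B = insert apex (spine j)"
        unfolding stage_def by blast
      then show False
      proof cases
        case 1
        obtain a b where ab: "a \<in> B" "b \<in> B" "snd a \<noteq> snd b" "a \<noteq> apex" "b \<noteq> apex" "fst a = fst b"
          and far: "fst a = 0 \<Longrightarrow> {snd a, snd b} = {0, n - 1}"
          using e n by (elim chordE) (fastforce simp: apex_def)+
        have "apex \<in> B" using e(2) by simp
        moreover have "\<not> B \<subseteq> column j" for j using ab(1-3) by (rule not_subset_column)
        ultimately show False using 1 ab far n
          by (elim cliqueE) (auto simp: apex_def spine_def doubleton_eq_iff)
      next
        case 2
        then have "e - {apex} \<subseteq> column j" using e(2) by blast
        moreover obtain a b where "a \<in> e - {apex}" "b \<in> e - {apex}" "snd a \<noteq> snd b"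
          using e(1)
        proof (cases rule: chordE)
          case (1 i j)
          then show ?thesis using that[of "(i, j)" "(i, Suc j)"] by (simp add: apex_def)
        next
          case (2 i)
          moreover have "n - 1 \<noteq> 1" using n by simp
          ultimately show ?thesis using that[of "(i, 0)" "(i, n - 1)"] n by (simp add: apex_def)
        qed
        ultimately show False using not_subset_column by blast
      next
        case 3
        then have "e \<subseteq> insert apex (spine j)" using e(2) by blast
        then show False using e(1) n by (elim chordE) (auto simp: apex_def spine_def)
      qed
    qed
    ultimately show "B \<in> full_cone - stage (n - 1)" using e(2) by (simp add: full_cone_def)
  qed
qed

lemma chord_facts:
  assumes "e \<in> chords" shows "e \<subseteq> V" "card e = 2" "apex \<notin> e"
proof -
  have "e \<subseteq> V \<and> card e = 2 \<and> apex \<notin> e"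
    using assms
  proof (cases rule: chordE)
    case (1 i j)
    then show ?thesis by (auto simp: V_def apex_def)
  next
    case (2 i)
    then show ?thesis using n by (auto simp: V_def apex_def)
  qed
  then show "e \<subseteq> V" "card e = 2" "apex \<notin> e" by auto
qed

text \<open>Of the m n horizontal edges, the path uses n - 1. The two families do not overlap
  because columns 0 and n - 1 are not consecutive.\<close>

lemma card_chords: "card chords = n * (m - 1) + 1"
proof -
  let ?f = "\<lambda>(i, j). {(i, j), (i, Suc j)}" and ?A = "{1..<m} \<times> {0..<n - 1}"
  let ?g = "\<lambda>i::nat. {(i, 0::nat), (i, n - 1)}"
  have "inj_on ?f ?A" by (auto simp: inj_on_def doubleton_eq_iff)
  then have "card (?f ` ?A) = (m - 1) * (n - 1)" by (simp add: card_image)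
  moreover have "inj_on ?g {0..<m}" by (auto simp: inj_on_def doubleton_eq_iff)
  then have "card (?g ` {0..<m}) = m" by (simp add: card_image)
  moreover have "?f ` ?A \<inter> ?g ` {0..<m} = {}"
    using n by (auto simp: doubleton_eq_iff)
  ultimately have "card chords = (m - 1) * (n - 1) + m"
    unfolding chords_def by (subst card_Un_disjoint) auto
  also have "\<dots> = n * (m - 1) + 1"
    using m n by (cases m; cases n) (auto simp: algebra_simps)
  finally show ?thesis .
qed

lemma dual_difference:
  "alexander_dual V (stage (n - 1)) - alexander_dual V full_cone = (\<lambda>e. V - insert apex e) ` chords"
proof -
  have sub: "insert apex e \<subseteq> V" if "e \<in> chords" for e using chord_facts(1)[OF that] apex_in_V by blast
  have 1: "\<sigma> \<in> alexander_dual V (stage (n - 1)) - alexander_dual V full_cone \<longleftrightarrow>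
        \<sigma> \<subseteq> V \<and> V - \<sigma> \<in> insert apex ` chords" for \<sigma>
    by (auto simp: alexander_dual_def simp flip: full_cone_minus_stage)
  have 2: "\<sigma> \<subseteq> V \<and> V - \<sigma> \<in> insert apex ` chords \<longleftrightarrow> \<sigma> \<in> (\<lambda>e. V - insert apex e) ` chords" for \<sigma>
  proof
    assume \<sigma>: "\<sigma> \<subseteq> V \<and> V - \<sigma> \<in> insert apex ` chords"
    then obtain e where e: "e \<in> chords" "V - \<sigma> = insert apex e" by blast
    have "\<sigma> = V - (V - \<sigma>)" using \<sigma> by blast
    then show "\<sigma> \<in> (\<lambda>e. V - insert apex e) ` chords" using e by simp
  next
    assume "\<sigma> \<in> (\<lambda>e. V - insert apex e) ` chords"
    then obtain e where e: "e \<in> chords" "\<sigma> = V - insert apex e" by blast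
    then have "V - \<sigma> = insert apex e" using sub[OF e(1)] by blast
    then show "\<sigma> \<subseteq> V \<and> V - \<sigma> \<in> insert apex ` chords" using e by auto
  qed
  show ?thesis by (rule set_eqI) (simp only: 1 2)
qed

lemma card_dual_difference:
  "card (alexander_dual V (stage (n - 1)) - alexander_dual V full_cone) = n * (m - 1) + 1"
proof -
  have "inj_on (\<lambda>e. V - insert apex e) chords"
  proof (rule inj_onI)
    fix e e' assume e: "e \<in> chords" "e' \<in> chords" and eq: "V - insert apex e = V - insert apex e'"
    have "e = V - (V - insert apex e) - {apex}" "e' = V - (V - insert apex e') - {apex}"
      using chord_facts[OF e(1)] chord_facts[OF e(2)] by auto
    then show "e = e'" using eq by simp
  qed
  then show ?thesis unfolding dual_difference card_chords[symmetric] by (rule card_image)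
qed

text \<open>The dual of a cone is a cone with the same apex: whether a set belongs to
  \<open>full_cone\<close> does not change when the apex is inserted or deleted, and complementation
  preserves this symmetry.\<close>

lemma dual_cone_with_cells:
  "cone_with_cells V (alexander_dual V (stage (n - 1))) (alexander_dual V full_cone) apex (m * n - 4)"
proof
  show "finite V" by (rule finite_V)
  show "alexander_dual V (stage (n - 1)) \<subseteq> Pow V" by (auto simp: alexander_dual_def)
  show "down_closed (alexander_dual V (stage (n - 1)))" "down_closed (alexander_dual V full_cone)"
    using down_closed_stage[of "n - 1"] down_closed_full_cone n
    by (auto intro!: down_closed_alexander_dual)
  show "alexander_dual V full_cone \<subseteq> alexander_dual V (stage (n - 1))"
    using stage_subset[of "n - 1"] n by (auto simp: alexander_dual_def)
  show "alexander_dual V full_cone \<noteq> {}"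
    using V_notin_full_cone by (auto simp: alexander_dual_def)
  show "insert apex \<sigma> \<in> alexander_dual V full_cone" if \<sigma>: "\<sigma> \<in> alexander_dual V full_cone" for \<sigma>
  proof -
    have "V - insert apex \<sigma> \<notin> full_cone"
    proof
      assume "V - insert apex \<sigma> \<in> full_cone"
      then have "insert apex (V - insert apex \<sigma>) \<in> full_cone"
        by (auto simp: full_cone_def)
      moreover have "V - \<sigma> \<subseteq> insert apex (V - insert apex \<sigma>)" by blast
      ultimately have "V - \<sigma> \<in> full_cone" using down_closedD[OF down_closed_full_cone] by blast
      then show False using \<sigma> by (simp add: alexander_dual_def)
    qed
    then show ?thesis using \<sigma> apex_in_V by (auto simp: alexander_dual_def)
  qed
  show "card \<sigma> = Suc (m * n - 4)"
    if \<sigma>: "\<sigma> \<in> alexander_dual V (stage (n - 1)) - alexander_dual V full_cone" for \<sigma>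
  proof -
    obtain e where e: "e \<in> chords" "\<sigma> = V - insert apex e" using \<sigma> unfolding dual_difference by blast
    note ch = chord_facts[OF e(1)]
    have "finite e" using ch(2) by (simp add: card_ge_0_finite)
    then have "card (insert apex e) = 3" using ch by simp
    moreover have "card \<sigma> = card V - card (insert apex e)"
      unfolding e(2) by (rule card_Diff_subset) (use ch apex_in_V \<open>finite e\<close> in auto)
    \<comment> \<open>This bound makes the truncated subtraction exact, so that m n - 3 vertices are
      indeed one more than the dimension m n - 4.\<close>
    moreover have "2 * 4 \<le> m * n" using m n by (rule mult_le_mono)
    ultimately show ?thesis by (simp add: card_V)
  qed
qed

section \<open>Cliques of the product graph and the total 2-cut complex\<close>

lemma cycle_edge_iff:
  "{j, j'} \<in> edges (cycle_graph n) \<longleftrightarrow>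
     (j' = Suc j \<and> j' < n) \<or> (j = Suc j' \<and> j < n) \<or> (j = 0 \<and> j' = n - 1) \<or> (j = n - 1 \<and> j' = 0)"
  by (auto simp: cycle_graph_def doubleton_eq_iff)

lemma product_edge_iff:
  "{(i, j), (i', j')} \<in> edges (complete_graph m \<box> cycle_graph n) \<longleftrightarrow>
     (i = i' \<and> i < m \<and> {j, j'} \<in> edges (cycle_graph n)) \<or>
     (j = j' \<and> j < n \<and> i < m \<and> i' < m \<and> i \<noteq> i')"
proof -
  have ce: "{a, b} \<in> edges (complete_graph m) \<longleftrightarrow> a < m \<and> b < m \<and> a \<noteq> b" for a b
    by (auto simp: complete_graph_def doubleton_eq_iff)
  have v: "vertices (complete_graph m) = {0..<m}" "vertices (cycle_graph n) = {0..<n}"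
    by (auto simp: complete_graph_def cycle_graph_def)
  show ?thesis
    by (auto simp: cartesian_product_def doubleton_eq_iff ce v insert_commute)
qed

lemma clique_pair_edge:
  assumes "{a, b} \<in> cliques" "a \<noteq> b"
  shows "{a, b} \<in> edges (complete_graph m \<box> cycle_graph n)"
proof -
  obtain i j i' j' where ab: "a = (i, j)" "b = (i', j')" by (cases a; cases b)
  show ?thesis
    using assms n m unfolding ab product_edge_iff cycle_edge_iff
    by (elim cliqueE) (auto simp: column_def spine_def doubleton_eq_iff)
qed

text \<open>Adjacent vertices in different columns share their row. A further vertex adjacent to
  both would have to lie in that row too and would produce a triangle in the cycle, which n \<ge> 4
  excludes. So a clique stays in one column or is a single horizontal edge.\<close>

lemma clique_in_cliques:
  assumes S: "S \<subseteq> V"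
    and adj: "\<And>a b. \<lbrakk>a \<in> S; b \<in> S; a \<noteq> b\<rbrakk> \<Longrightarrow> {a, b} \<in> edges (complete_graph m \<box> cycle_graph n)"
  shows "S \<in> cliques"
proof (cases "\<exists>a\<in>S. \<exists>b\<in>S. snd a \<noteq> snd b")
  case False
  show ?thesis
  proof (cases "S = {}")
    case True
    then show ?thesis using n by (intro column_clique[of 0]) auto
  next
    case ne: False
    then obtain a where a: "a \<in> S" by blast
    show ?thesis
    proof (rule column_clique[of "snd a"])
      show "snd a < n" using a S by (auto simp: V_def)
      show "S \<subseteq> column (snd a)"
      proof
        fix b assume b: "b \<in> S"
        then have "snd b = snd a" "b \<in> V" using False a S by blast+
        then show "b \<in> column (snd a)" by (cases b) (simp add: V_def column_def)
      qed
    qed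
  qed
next
  case True
  then obtain i j i' j' where ab: "(i, j) \<in> S" "(i', j') \<in> S" "j \<noteq> j'" by fastforce
  then have ii: "i' = i" "i < m" and jj: "{j, j'} \<in> edges (cycle_graph n)"
    using adj[of "(i, j)" "(i', j')"] by (auto simp: product_edge_iff)
  have "c = (i, j) \<or> c = (i, j')" if "c \<in> S" for c
  proof (rule ccontr)
    assume c: "\<not> ?thesis"
    obtain k l where kl: "c = (k, l)" by (cases c)
    have "{(i, j), (k, l)} \<in> edges (complete_graph m \<box> cycle_graph n)"
         "{(i, j'), (k, l)} \<in> edges (complete_graph m \<box> cycle_graph n)"
      using adj[of "(i, j)" c] adj[of "(i, j')" c] ab ii c that kl by auto
    then show False
      using c n jj ab(3) unfolding kl product_edge_iff cycle_edge_iff by auto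
  qed
  then have S_eq: "S = {(i, j), (i, j')}" using ab ii by auto
  have "{(i, j), (i, j')} \<in> cliques"
    if "j' = Suc j \<and> j' < n \<or> j = 0 \<and> j' = n - 1" for j j'
  proof (cases "j = 0 \<and> j' = n - 1")
    case True
    then show ?thesis using ii by (auto simp: cliques_def chords_def)
  next
    case False
    then have "j' = Suc j" "Suc j < n" using that by auto
    show ?thesis
    proof (cases "i = 0")
      case True
      then show ?thesis using spine_clique[OF \<open>Suc j < n\<close>] \<open>j' = Suc j\<close> by (simp add: spine_def)
    next
      case False
      then have "(i, j) \<in> {1..<m} \<times> {0..<n - 1}" using ii \<open>Suc j < n\<close> by auto
      then have "{(i, j), (i, j')} \<in> chords"
        unfolding chords_def \<open>j' = Suc j\<close> by (intro UnI1) force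
      then show ?thesis by (simp add: cliques_def)
    qed
  qed
  note line = this
  from jj consider "j' = Suc j \<and> j' < n \<or> j = 0 \<and> j' = n - 1"
    | "j = Suc j' \<and> j < n \<or> j' = 0 \<and> j = n - 1"
    unfolding cycle_edge_iff by blast
  then have "{(i, j), (i, j')} \<in> cliques"
  proof cases
    case 1
    then show ?thesis by (rule line)
  next
    case 2
    then have "{(i, j'), (i, j)} \<in> cliques" by (rule line)
    then show ?thesis by (simp only: insert_commute)
  qed
  then show ?thesis using S_eq by simp
qed

text \<open>Facets are the complements of nonadjacent pairs, and a set of vertices fails to be a
  clique exactly if it contains such a pair. So \<tau> lies in a facet if and only if its complement
  is not a clique.\<close>

lemma total_2_cut_complex_eq:
  "total_2_cut_complex (complete_graph m \<box> cycle_graph n) = alexander_dual V cliques"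
proof -
  let ?G = "complete_graph m \<box> cycle_graph n"
  have vG: "vertices ?G = V"
    by (simp add: cartesian_product_def complete_graph_def cycle_graph_def V_def)
  have "finite_simple_graph ?G"
    using finite_simple_graph_complete_graph finite_simple_graph_cycle_graph n
    by (intro finite_simple_graph_cartesian_product) auto
  then have sz: "card e = 2" if "e \<in> edges ?G" for e
    using that by (auto simp: finite_simple_graph_def)
  have "\<tau> \<in> total_2_cut_complex ?G \<longleftrightarrow> \<tau> \<in> alexander_dual V cliques" for \<tau>
  proof
    assume "\<tau> \<in> total_2_cut_complex ?G"
    then obtain \<sigma> where \<sigma>: "\<tau> \<subseteq> \<sigma>" "\<sigma> \<subseteq> V" "card \<sigma> + 2 = card V"
      and no: "\<And>e. e \<in> edges ?G \<Longrightarrow> \<not> e \<subseteq> V - \<sigma>"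
      by (auto simp: total_2_cut_complex_def total_2_cut_facets_def induced_subgraph_def vG)
    have "card (V - \<sigma>) = 2"
      using \<sigma> finite_V by (simp add: card_Diff_subset finite_subset)
    then obtain a b where ab: "V - \<sigma> = {a, b}" "a \<noteq> b" by (meson card_2_iff)
    have "{a, b} \<notin> cliques" using clique_pair_edge ab no by blast
    moreover have "{a, b} \<subseteq> V - \<tau>" using ab(1) \<sigma>(1) by blast
    ultimately have "V - \<tau> \<notin> cliques" using down_closedD[OF down_closed_cliques] by blast
    then show "\<tau> \<in> alexander_dual V cliques" using \<sigma> by (auto simp: alexander_dual_def)
  next
    assume "\<tau> \<in> alexander_dual V cliques"
    then have \<tau>: "\<tau> \<subseteq> V" "V - \<tau> \<notin> cliques" by (auto simp: alexander_dual_def)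
    then obtain a b where ab: "a \<in> V - \<tau>" "b \<in> V - \<tau>" "a \<noteq> b" "{a, b} \<notin> edges ?G"
      using clique_in_cliques[of "V - \<tau>"] by blast
    define \<sigma> where "\<sigma> = V - {a, b}"
    have abV: "{a, b} \<subseteq> V" using ab by blast
    have "\<sigma> \<subseteq> V" by (auto simp: \<sigma>_def)
    moreover have "card \<sigma> = card V - 2" unfolding \<sigma>_def using abV ab(3) by (simp add: card_Diff_subset)
    moreover have "2 \<le> card V" using card_mono[OF finite_V abV] ab(3) by simp
    moreover have "edges (induced_subgraph ?G (V - \<sigma>)) = {}"
    proof -
      have "e \<notin> edges ?G" if "e \<subseteq> {a, b}" for e
      proof
        assume "e \<in> edges ?G"
        then have "e = {a, b}" using sz[of e] that ab(3) by (intro card_seteq) auto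
        then show False using \<open>e \<in> edges ?G\<close> ab(4) by simp
      qed
      moreover have "V - \<sigma> = {a, b}" using abV by (auto simp: \<sigma>_def)
      ultimately show ?thesis by (auto simp: induced_subgraph_def)
    qed
    ultimately have "\<sigma> \<in> total_2_cut_facets ?G"
      by (simp add: total_2_cut_facets_def vG)
    moreover have "\<tau> \<subseteq> \<sigma>" using \<tau> ab by (auto simp: \<sigma>_def)
    ultimately show "\<tau> \<in> total_2_cut_complex ?G" by (auto simp: total_2_cut_complex_def)
  qed
  then show ?thesis by blast
qed

end

theorem theorem3p14:
  fixes m n :: nat
  assumes "m \<ge> 2" and "n \<ge> 4"
  shows "geometric_realization (total_2_cut_complex (complete_graph m \<box> cycle_graph n))
           homotopy_equivalent_space wedge_of_spheres (n * (m - 1) + 1) (m * n - 4)"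
proof -
  interpret prism m n using assms by unfold_locales
  interpret cone_with_cells V "alexander_dual V (stage (n - 1))" "alexander_dual V full_cone"
    apex "m * n - 4"
    by (rule dual_cone_with_cells)
  have "geometric_realization (alexander_dual V (stage (n - 1))) homotopy_equivalent_space
        wedge_of_spheres (n * (m - 1) + 1) (m * n - 4)"
  proof -
    have "alexander_dual V (stage (n - 1)) - alexander_dual V full_cone \<noteq> {}"
      using card_dual_difference by (intro notI) (simp only: card.empty)
    from homotopy_equivalent_wedge_of_spheres[OF this] show ?thesis
      unfolding card_dual_difference .
  qed
  moreover have "geometric_realization (alexander_dual V cliques) homotopy_equivalent_space
      geometric_realization (alexander_dual V (stage (n - 1)))"
    using cliques_stage[of "n - 1"] assms by simp
  ultimately show ?thesis
    unfolding total_2_cut_complex_eq using homotopy_eqv_trans by blast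
qed

end
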